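(* For $n\ge1$ let $N_B(n)$, $N_R(n)$, $N_G(n)$ denote the total number of brown, red and green vertices respectively, summed over all $n^{n-2}$ labeled trees on the vertex set $\{1,\dots,n\}$. Let $T(x)=\sum_{n\ge1}\frac{n^{n-1}}{n!}x^n$ and $F_c(x)=\sum_{n\ge1}\frac{N_c(n)}{n!}x^n$ for $c\in\{B,R,G\}$. Then, as formal power series, $$F_B=T(x)+T(-T(x))-T(-T(x))^2,\qquad F_R=T(-T(x))^2,\qquad F_G=-T(-T(x)).$$ Moreover, for all $n\ge1$, $$\frac{N_B(n)}{n^{n-1}}=1+\sum_{l=1}^n\Big(\frac{-l}{n}\Big)^l\Big(\frac2l-1\Big)\binom nl,\quad \frac{N_R(n)}{n^{n-1}}=-2\sum_{l=1}^n\Big(\frac{-l}{n}\Big)^l\Big(\frac1l-1\Big)\binom nl,\quad \frac{N_G(n)}{n^{n-1}}=-\sum_{l=1}^n\Big(\frac{-l}{n}\Big)^l\binom nl,$$ the first values (for $n=1,2,\dots,10$) are $N_B=(0,0,3,4,185,1026,30457,362664,10245825,195060070)$, $N_R=(0,2,0,48,120,4560,35700,1048992,15514128,456726240)$, $N_G=(1,0,6,12,320,2190,51492,685496,17286768,348213690)$, and as $n\to\infty$, $$\frac{N_B(n)}{n^{n-1}}\to 1+\frac{\Omega}{1+\Omega}-2\Omega\approx0.2276096757,\quad \frac{N_R(n)}{n^{n-1}}\to\frac{2\Omega^2}{1+\Omega}\approx0.4104940676,\quad \frac{N_G(n)}{n^{n-1}}\to\frac{\Omega}{1+\Omega}\approx0.3618962567,$$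 where $\Omega\approx0.567143$ is the unique real solution of $\Omega e^{\Omega}=1$.
   Context: For a finite tree $A=(V,\mathcal E)$, its b-coloring is the unique triple $(B,\mathcal R,G)$ with $B,G\subseteq V$, $\mathcal R\subseteq\mathcal E$, such that $B$, $G$ and the set of end-vertices of edges of $\mathcal R$ partition $V$, the edges in $\mathcal R$ are pairwise non-adjacent, every edge with one end-vertex in $G$ has its other end-vertex in $B$, and each vertex of $B$ is joined to $G$ by at least two edges. (Equivalently, $B$ is the set of vertices lying in every minimum-cardinality vertex cover, $G$ the set of vertices lying in no minimum-cardinality vertex cover, and $\mathcal R$ the set of edges lying in every maximum-cardinality matching.) A vertex is brown if it lies in $B$, green if it lies in $G$, and red if it is an end-vertex of an edge of $\mathcal R$. *)

theory Defs
  imports Complex_Main "HOL-Computational_Algebra.Formal_Power_Series"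
begin

definition simple_edges :: "nat set \<Rightarrow> nat set set" where
  "simple_edges V = {{u, v} | u v. u \<in> V \<and> v \<in> V \<and> u \<noteq> v}"

definition adj :: "nat set set \<Rightarrow> nat \<Rightarrow> nat \<Rightarrow> bool" where
  "adj E u v \<longleftrightarrow> {u, v} \<in> E \<and> u \<noteq> v"

definition connected_graph :: "nat set \<Rightarrow> nat set set \<Rightarrow> bool" where
  "connected_graph V E \<longleftrightarrow> (\<forall>u\<in>V. \<forall>v\<in>V. (adj E)\<^sup>*\<^sup>* u v)"

definition is_cycle :: "nat set set \<Rightarrow> nat list \<Rightarrow> bool" where
  "is_cycle E cs \<longleftrightarrow> length cs \<ge> 3 \<and> distinct cs \<and>
     (\<forall>i < length cs - 1. adj E (cs ! i) (cs ! Suc i)) \<and> adj E (last cs) (hd cs)"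

definition acyclic_graph :: "nat set set \<Rightarrow> bool" where
  "acyclic_graph E \<longleftrightarrow> \<not> (\<exists>cs. is_cycle E cs)"

definition is_tree :: "nat set \<Rightarrow> nat set set \<Rightarrow> bool" where
  "is_tree V E \<longleftrightarrow> finite V \<and> E \<subseteq> simple_edges V \<and> connected_graph V E \<and> acyclic_graph E"

definition labeled_trees :: "nat \<Rightarrow> nat set set set" where
  "labeled_trees n = {E. is_tree {1..n} E}"

definition is_bcoloring :: "nat set \<Rightarrow> nat set set \<Rightarrow> nat set \<Rightarrow> nat set set \<Rightarrow> nat set \<Rightarrow> bool" where
  "is_bcoloring V E B R G \<longleftrightarrow>
     B \<subseteq> V \<and> G \<subseteq> V \<and> R \<subseteq> E \<and>
     B \<inter> G = {} \<and> B \<inter> \<Union>R = {} \<and> G \<inter> \<Union>R = {} \<and> B \<union> G \<union> \<Union>R = V \<and>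
     (\<forall>e\<in>R. \<forall>f\<in>R. e \<noteq> f \<longrightarrow> e \<inter> f = {}) \<and>
     (\<forall>u v. {u, v} \<in> E \<and> u \<noteq> v \<and> u \<in> G \<longrightarrow> v \<in> B) \<and>
     (\<forall>b\<in>B. card {e \<in> E. b \<in> e \<and> (\<exists>g\<in>G. e = {b, g})} \<ge> 2)"

definition bcoloring :: "nat set \<Rightarrow> nat set set \<Rightarrow> nat set \<times> nat set set \<times> nat set" where
  "bcoloring V E = (THE (B, R, G). is_bcoloring V E B R G)"

definition brown :: "nat set \<Rightarrow> nat set set \<Rightarrow> nat set" where
  "brown V E = fst (bcoloring V E)"

definition red :: "nat set \<Rightarrow> nat set set \<Rightarrow> nat set" where
  "red V E = \<Union> (fst (snd (bcoloring V E)))"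

definition green :: "nat set \<Rightarrow> nat set set \<Rightarrow> nat set" where
  "green V E = snd (snd (bcoloring V E))"

definition N_B :: "nat \<Rightarrow> nat" where
  "N_B n = (\<Sum>E\<in>labeled_trees n. card (brown {1..n} E))"

definition N_R :: "nat \<Rightarrow> nat" where
  "N_R n = (\<Sum>E\<in>labeled_trees n. card (red {1..n} E))"

definition N_G :: "nat \<Rightarrow> nat" where
  "N_G n = (\<Sum>E\<in>labeled_trees n. card (green {1..n} E))"

definition T_fps :: "real fps" where
  "T_fps = Abs_fps (\<lambda>n. if n = 0 then 0 else real n ^ (n - 1) / fact n)"

definition egf :: "(nat \<Rightarrow> nat) \<Rightarrow> real fps" where
  "egf N = Abs_fps (\<lambda>n. if n = 0 then 0 else real (N n) / fact n)"

definition Omega :: real where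
  "Omega = (THE w. w * exp w = 1)"

end

theory Submission
  imports Defs "HOL-Analysis.Uniform_Limit" "HOL-Analysis.Infinite_Sum" "HOL-Analysis.Harmonic_Numbers"
begin

unbundle no vec_syntax
unbundle fps_syntax

text \<open>
  Call a rooted tree light if none of the subtrees hanging off its root is light. In a tree, orient
  each edge both ways and look at the component that remains at the tail. A vertex is green, red or
  brown according to whether none, exactly one, or at least two of its neighbours are light in their
  component, and the edges of \<open>\<R>\<close> are those with two light components.

  Cutting a tree at a directed edge yields a pair of rooted trees on complementary vertex sets. With
  \<open>L\<close> the generating function of light rooted trees this gives \<open>F\<^sub>G = L\<close> and \<open>F\<^sub>R = L\<^sup>2\<close>; cutting
  at the first edge of the path from the root to a second marked vertex gives
  \<open>x T' = T + T x T'\<close> and \<open>x L' = L + L x (T - L)'\<close>. The first equation implies Lagrange's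
  formula for the powers of \<open>T\<close>, and the second one is solved by \<open>L = - T(- T)\<close>.

  For the limits, \<open>T = x exp T\<close> and \<open>L = x exp (T - L)\<close> at the singularity \<open>x = exp (- 1)\<close> give
  \<open>T = 1\<close> and \<open>L = \<Omega>\<close>. With \<open>H = L / (1 + L)\<close> the second equation reads \<open>x L' = H (1 + x T')\<close>;
  after scaling by \<open>exp (- n)\<close> the coefficients of \<open>H\<close> are \<open>O(n powr (- 3 / 2))\<close> while those of
  \<open>1 + x T'\<close> are of the exact order \<open>n powr (- 1 / 2)\<close> and have ratios tending to 1, so
  the coefficients of \<open>L\<close> and \<open>T\<close> have the limit quotient \<open>H(exp (- 1)) = \<Omega> / (1 + \<Omega>)\<close>.
\<close>

section \<open>Cutting a tree at an edge\<close>

abbreviation reach :: "nat set set \<Rightarrow> nat \<Rightarrow> nat \<Rightarrow> bool" where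
  "reach E \<equiv> (adj E)\<^sup>*\<^sup>*"

lemma adj_commute: "adj E u v \<longleftrightarrow> adj E v u"
  by (auto simp: adj_def insert_commute)

lemma adj_mono: "adj E u v \<Longrightarrow> E \<subseteq> F \<Longrightarrow> adj F u v"
  by (auto simp: adj_def)

lemma adj_Diff: "adj (E - {{a, b}}) u v \<longleftrightarrow> adj E u v \<and> {u, v} \<noteq> {a, b}"
  by (auto simp: adj_def)

lemma reach_mono: "reach E u v \<Longrightarrow> E \<subseteq> F \<Longrightarrow> reach F u v"
  by (rule rtranclp_mono[THEN predicate2D, rotated]) (auto intro: adj_mono)

lemma reach_sym: "reach E u v \<Longrightarrow> reach E v u"
proof (induction rule: rtranclp_induct)
  case (step y z)
  then show ?case
    by (meson adj_commute converse_rtranclp_into_rtranclp)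
qed simp

text \<open>Cycles are lists of distinct vertices, so walks have to be made simple before an edge
  can close them. When the walk revisits a vertex, the list is cut back to the earlier
  occurrence.\<close>

lemma reach_imp_path:
  assumes "reach E u v"
  obtains ps where "distinct ps" "ps \<noteq> []" "hd ps = u" "last ps = v" "successively (adj E) ps"
proof -
  from assms have "\<exists>ps. distinct ps \<and> ps \<noteq> [] \<and> hd ps = u \<and> last ps = v \<and> successively (adj E) ps"
  proof (induction rule: rtranclp_induct)
    case base
    show ?case by (rule exI[of _ "[u]"]) auto
  next
    case (step y z)
    then obtain ps where ps: "distinct ps" "ps \<noteq> []" "hd ps = u" "last ps = y"
      "successively (adj E) ps" by blast
    show ?case
    proof (cases "z \<in> set ps")
      case True
      then obtain xs ys where eq: "ps = xs @ z # ys" by (meson split_list)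
      show ?thesis
        using ps unfolding eq
        by (intro exI[of _ "xs @ [z]"]) (auto simp: successively_append_iff hd_append)
    next
      case False
      then show ?thesis
        using ps step.hyps
        by (intro exI[of _ "ps @ [z]"]) (auto simp: successively_append_iff)
    qed
  qed
  then show ?thesis using that by blast
qed

text \<open>A simple path from \<open>u\<close> to \<open>v\<close> avoiding the edge is closed by
  that edge to a cycle. Its length is at least 3, since a list of length 1 would give
  \<open>u = v\<close> and one of length 2 would use the deleted edge.\<close>

lemma acyclic_imp_bridge:
  assumes "acyclic_graph E" "adj E u v"
  shows "\<not> reach (E - {{u, v}}) u v"
proof
  assume "reach (E - {{u, v}}) u v"
  then obtain ps where ps: "distinct ps" "ps \<noteq> []" "hd ps = u" "last ps = v"
    "successively (adj (E - {{u, v}})) ps" by (rule reach_imp_path)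
  have uv: "u \<noteq> v" using assms by (auto simp: adj_def)
  have "length ps \<ge> 3"
  proof (rule ccontr)
    assume "\<not> length ps \<ge> 3"
    then have "length ps = 1 \<or> length ps = 2"
      using ps(2) by (cases ps) (auto simp: numeral_eq_Suc not_le less_Suc_eq)
    then obtain a b where "ps = [a] \<or> ps = [a, b]"
      by (auto simp: length_Suc_conv numeral_eq_Suc)
    then show False using ps uv by (auto simp: adj_def)
  qed
  moreover have "\<forall>i<length ps - 1. adj E (ps ! i) (ps ! Suc i)"
    using ps(5) by (auto simp: successively_conv_nth adj_Diff)
  ultimately have "is_cycle E ps"
    unfolding is_cycle_def using ps assms(2) by (auto simp: adj_commute)
  then show False using assms by (auto simp: acyclic_graph_def)
qed

text \<open>The closing edge of a cycle is no bridge, because its ends stay joined along the rest of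
  the cycle. This criterion proves joined graphs acyclic without an analysis of their
  cycles.\<close>

lemma bridges_imp_acyclic:
  assumes "\<And>u v. adj E u v \<Longrightarrow> \<not> reach (E - {{u, v}}) u v"
  shows "acyclic_graph E"
  unfolding acyclic_graph_def
proof
  assume "\<exists>cs. is_cycle E cs"
  then obtain cs where cs: "length cs \<ge> 3" "distinct cs"
    "\<And>i. i < length cs - 1 \<Longrightarrow> adj E (cs ! i) (cs ! Suc i)" "adj E (last cs) (hd cs)"
    by (auto simp: is_cycle_def)
  define n where "n = length cs - 1"
  have ne: "cs \<noteq> []" using cs by auto
  have hd: "hd cs = cs ! 0" and last: "last cs = cs ! n"
    using ne by (auto simp: hd_conv_nth last_conv_nth n_def)
  have "reach (E - {{cs ! 0, cs ! n}}) (cs ! 0) (cs ! j)" if "j \<le> n" for j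
    using that
  proof (induction j)
    case (Suc j)
    have "{cs ! j, cs ! Suc j} \<noteq> {cs ! 0, cs ! n}"
    proof
      assume "{cs ! j, cs ! Suc j} = {cs ! 0, cs ! n}"
      then have "cs ! j = cs ! n \<or> cs ! j = cs ! 0 \<and> cs ! Suc j = cs ! n"
        by (auto simp: doubleton_eq_iff)
      then have "j = n \<or> j = 0 \<and> Suc j = n"
        using Suc.prems cs(1) nth_eq_iff_index_eq[OF cs(2), of j n] nth_eq_iff_index_eq[OF cs(2), of j 0]
          nth_eq_iff_index_eq[OF cs(2), of "Suc j" n] ne
        by (auto simp: n_def)
      then show False using Suc.prems cs(1) by (auto simp: n_def)
    qed
    then have "adj (E - {{cs ! 0, cs ! n}}) (cs ! j) (cs ! Suc j)"
      using cs(3)[of j] Suc.prems by (auto simp: adj_Diff n_def)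
    then show ?case using Suc by (meson Suc_leD rtranclp.rtrancl_into_rtrancl)
  qed simp
  from this[of n] assms[of "cs ! 0" "cs ! n"] cs(4) show False
    by (simp add: hd last adj_commute)
qed

section \<open>The components left by cutting an edge\<close>

definition side :: "nat set set \<Rightarrow> nat \<Rightarrow> nat \<Rightarrow> nat set" where
  "side E u v = {x. reach (E - {{u, v}}) u x}"

text \<open>The end that keeps its component comes first: with \<open>c\<close> a neighbour of the
  root \<open>r\<close>, \<open>branch E c r\<close> is the subtree hanging off \<open>r\<close> at
  \<open>c\<close>.\<close>

definition branch :: "nat set set \<Rightarrow> nat \<Rightarrow> nat \<Rightarrow> nat set set" where
  "branch E u v = {e \<in> E. e \<subseteq> side E u v}"

lemma side_self [simp]: "u \<in> side E u v"
  by (simp add: side_def)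

lemma side_step:
  assumes "x \<in> side E u v" "adj E x y" "{x, y} \<noteq> {u, v}"
  shows "y \<in> side E u v"
proof -
  have "adj (E - {{u, v}}) x y" using assms by (simp add: adj_Diff)
  then show ?thesis using assms(1) unfolding side_def mem_Collect_eq
    by (rule rtranclp.rtrancl_into_rtrancl[rotated])
qed

lemma branch_subset: "branch E u v \<subseteq> E"
  by (auto simp: branch_def)

lemma adj_branch: "adj (branch E u v) x y \<longleftrightarrow> adj E x y \<and> x \<in> side E u v \<and> y \<in> side E u v"
  by (auto simp: branch_def adj_def)

locale tree =
  fixes V :: "nat set" and E :: "nat set set"
  assumes tree: "is_tree V E"
begin

lemma finite_V: "finite V"
  using tree by (simp add: is_tree_def)

lemma edge_in: "adj E u v \<Longrightarrow> u \<in> V \<and> v \<in> V"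
  using tree by (auto simp: is_tree_def simple_edges_def adj_def doubleton_eq_iff)

lemma edgeE:
  assumes "e \<in> E" obtains u v where "e = {u, v}" "adj E u v"
  using assms tree by (force simp: is_tree_def simple_edges_def adj_def)

lemma edges_Pow: "E \<subseteq> Pow V"
  using tree by (auto simp: is_tree_def simple_edges_def)

lemma finite_E: "finite E"
  using edges_Pow finite_V by (meson finite_Pow_iff finite_subset)

lemma connected: "u \<in> V \<Longrightarrow> v \<in> V \<Longrightarrow> reach E u v"
  using tree by (simp add: is_tree_def connected_graph_def)

lemma bridge: "adj E u v \<Longrightarrow> \<not> reach (E - {{u, v}}) u v"
  using tree acyclic_imp_bridge by (auto simp: is_tree_def)

lemma not_in_side: "adj E u v \<Longrightarrow> v \<notin> side E u v"
  using bridge by (simp add: side_def)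

lemma side_subset:
  assumes "u \<in> V" shows "side E u v \<subseteq> V"
proof
  fix x assume "x \<in> side E u v"
  then have "reach (E - {{u, v}}) u x" by (simp add: side_def)
  then show "x \<in> V"
  proof (induction rule: rtranclp_induct)
    case (step y z) then show ?case using edge_in by (auto simp: adj_Diff)
  qed (use assms in simp)
qed

lemma finite_side: "u \<in> V \<Longrightarrow> finite (side E u v)"
  using side_subset finite_V finite_subset by blast

lemma side_disjoint:
  assumes "adj E u v" shows "side E u v \<inter> side E v u = {}"
proof -
  have "reach (E - {{u, v}}) u v" if "x \<in> side E u v" "x \<in> side E v u" for x
    using that reach_sym[of "E - {{u, v}}" v x]
    by (auto simp: side_def insert_commute)
  then show ?thesis using bridge[OF assms] by blast
qed

lemma side_Un:
  assumes "adj E u v" shows "side E u v \<union> side E v u = V"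
proof
  show "side E u v \<union> side E v u \<subseteq> V" using side_subset edge_in[OF assms] by blast
  show "V \<subseteq> side E u v \<union> side E v u"
  proof
    fix x assume "x \<in> V"
    then have "reach E u x" using connected edge_in[OF assms] by blast
    then show "x \<in> side E u v \<union> side E v u"
    proof (induction rule: rtranclp_induct)
      case (step y z)
      show ?case
      proof (cases "{y, z} = {u, v}")
        case True then show ?thesis by (auto simp: doubleton_eq_iff)
      next
        case False
        then show ?thesis using step side_step[of y E u v z] side_step[of y E v u z]
          by (auto simp: insert_commute)
      qed
    qed simp
  qed
qed

lemma edge_split:
  assumes "adj E u v" shows "branch E u v \<union> branch E v u \<union> {{u, v}} = E"
proof
  show "branch E u v \<union> branch E v u \<union> {{u, v}} \<subseteq> E"
    using assms by (auto simp: branch_def adj_def)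
  show "E \<subseteq> branch E u v \<union> branch E v u \<union> {{u, v}}"
  proof
    fix e assume "e \<in> E"
    then obtain a b where e: "e = {a, b}" "adj E a b" by (rule edgeE)
    show "e \<in> branch E u v \<union> branch E v u \<union> {{u, v}}"
    proof (cases "{a, b} = {u, v}")
      case False
      have "a \<in> side E u v \<or> a \<in> side E v u" using side_Un[OF assms] edge_in[OF e(2)] by blast
      then show ?thesis
      proof
        assume "a \<in> side E u v"
        with side_step[OF this e(2) False] \<open>e \<in> E\<close> e show ?thesis by (auto simp: branch_def)
      next
        assume "a \<in> side E v u"
        with side_step[OF this e(2)] False \<open>e \<in> E\<close> e show ?thesis
          by (auto simp: branch_def insert_commute)
      qed
    qed (use e in auto)
  qed
qed

lemma branch_reach:
  assumes "x \<in> side E u v" shows "reach (branch E u v) u x"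
proof -
  from assms have "reach (E - {{u, v}}) u x" by (simp add: side_def)
  then show ?thesis
  proof (induction rule: rtranclp_induct)
    case (step y z)
    have y: "y \<in> side E u v" using step by (simp add: side_def)
    then have "z \<in> side E u v" using side_step step by (auto simp: adj_Diff)
    with y step have "adj (branch E u v) y z" by (auto simp: adj_branch adj_Diff)
    then show ?case using step by (meson rtranclp.rtrancl_into_rtrancl)
  qed simp
qed

lemma tree_branch:
  assumes "u \<in> V" shows "is_tree (side E u v) (branch E u v)"
  unfolding is_tree_def
proof (intro conjI)
  show "finite (side E u v)" using assms by (rule finite_side)
  show "branch E u v \<subseteq> simple_edges (side E u v)"
  proof
    fix e assume e: "e \<in> branch E u v"
    then obtain a b where "e = {a, b}" "adj E a b"
      using edgeE[of e] by (auto simp: branch_def)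
    then show "e \<in> simple_edges (side E u v)"
      using e by (auto simp: branch_def simple_edges_def adj_def)
  qed
  show "connected_graph (side E u v) (branch E u v)"
    unfolding connected_graph_def
    by (meson branch_reach reach_sym rtranclp_trans)
  show "acyclic_graph (branch E u v)"
  proof -
    have "is_cycle E cs" if "is_cycle (branch E u v) cs" for cs
      using that adj_mono[OF _ branch_subset] unfolding is_cycle_def by blast
    then show ?thesis using tree unfolding is_tree_def acyclic_graph_def by blast
  qed
qed

lemma branch_psubset:
  assumes "adj E u v" shows "branch E u v \<subset> E"
proof -
  have "{u, v} \<in> E" "{u, v} \<notin> branch E u v"
    using assms not_in_side[OF assms] by (auto simp: branch_def adj_def)
  then show ?thesis using branch_subset by blast
qed

text \<open>The component of \<open>w\<close> beyond \<open>u\<close> never reaches \<open>u\<close>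
  and hence never uses the edge to \<open>v\<close>, so removing that edge first changes nothing.
  This keeps the recursion for light branches inside one fixed tree.\<close>

lemma side_branch:
  assumes uv: "adj E u v" and uw: "adj E u w" and wv: "w \<noteq> v"
  shows "side (branch E u v) w u = side E w u"
proof
  show "side (branch E u v) w u \<subseteq> side E w u"
    unfolding side_def using reach_mono[of "branch E u v - {{w, u}}" w _ "E - {{w, u}}"]
    by (auto simp: branch_def)
  have wu: "adj E w u" using uw by (simp add: adj_commute)
  have w: "w \<in> side E u v"
    using side_step[OF side_self uw] uw uv wv by (auto simp: doubleton_eq_iff adj_def)
  show "side E w u \<subseteq> side (branch E u v) w u"
  proof
    fix x assume "x \<in> side E w u"
    then have "reach (E - {{w, u}}) w x" by (simp add: side_def)
    then have "x \<in> side (branch E u v) w u \<and> x \<in> side E u v"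
    proof (induction rule: rtranclp_induct)
      case base then show ?case using w by simp
    next
      case (step y z)
      have "y \<in> side E w u" using step by (simp add: side_def)
      then have "y \<noteq> u" using not_in_side[OF wu] by blast
      moreover have "y \<noteq> v" using step not_in_side[OF uv] by blast
      ultimately have "{y, z} \<noteq> {u, v}" by (auto simp: doubleton_eq_iff)
      then have z: "z \<in> side E u v" using side_step[of y E u v z] step by (auto simp: adj_Diff)
      then have "adj (branch E u v) y z" using step by (auto simp: adj_branch adj_Diff)
      then show ?case using side_step[of y "branch E u v" w u z] step z by (auto simp: adj_Diff)
    qed
    then show "x \<in> side (branch E u v) w u" by blast
  qed
qed

lemma side_side_subset:
  assumes uv: "adj E u v" and uw: "adj E u w" and wv: "w \<noteq> v"
  shows "side E w u \<subseteq> side E u v - {u}"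
proof -
  have wu: "adj E w u" using uw by (simp add: adj_commute)
  have w: "w \<in> side E u v"
    using side_step[OF side_self uw] uw uv wv by (auto simp: doubleton_eq_iff adj_def)
  have "side (branch E u v) w u \<subseteq> side E u v"
    using tree.side_subset[of "side E u v" "branch E u v" w u] tree_branch[of u v] edge_in[OF uv] w
    by (auto simp: tree_def)
  then show ?thesis using side_branch[OF assms] not_in_side[OF wu] by blast
qed

lemma branch_branch:
  assumes uv: "adj E u v" and uw: "adj E u w" and wv: "w \<noteq> v"
  shows "branch (branch E u v) w u = branch E w u"
  using side_side_subset[OF assms]
  unfolding branch_def side_branch[OF assms, unfolded branch_def] by blast

lemma sides_disjoint:
  assumes rc: "adj E r c" and rd: "adj E r d" and cd: "c \<noteq> d"
  shows "side E c r \<inter> side E d r = {}"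
proof -
  have "side E d r \<subseteq> side E r c"
    using side_side_subset[OF rc rd] cd by blast
  then show ?thesis using side_disjoint[OF rc] by blast
qed

text \<open>Together with \<open>sides_disjoint\<close> this partitions the vertices other than the
  root, which is where the factor \<open>card V - 1\<close> of \<open>pointed_recurrence\<close>
  comes from.\<close>

lemma sides_cover:
  assumes r: "r \<in> V" shows "(\<Union>c\<in>{c. adj E r c}. side E c r) = V - {r}"
proof
  show "(\<Union>c\<in>{c. adj E r c}. side E c r) \<subseteq> V - {r}"
    using side_subset edge_in not_in_side by (fastforce simp: adj_commute)
  show "V - {r} \<subseteq> (\<Union>c\<in>{c. adj E r c}. side E c r)"
  proof
    fix x assume x: "x \<in> V - {r}"
    then have "reach E r x" using connected r by blast
    then have "x = r \<or> (\<exists>c. adj E r c \<and> x \<in> side E c r)"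
    proof (induction rule: rtranclp_induct)
      case (step y z)
      show ?case
      proof (cases "y = r \<or> z = r")
        case True
        then show ?thesis using step.hyps side_self by blast
      next
        case False
        then show ?thesis using step side_step[of y E _ r z] by (fastforce simp: doubleton_eq_iff)
      qed
    qed simp
    then show "x \<in> (\<Union>c\<in>{c. adj E r c}. side E c r)" using x by auto
  qed
qed

end

text \<open>The inverse of cutting at a directed edge. Acyclicity is shown by proving every edge a
  bridge: a detour around an edge of one part would project to a detour within that part.\<close>

lemma is_tree_join:
  assumes 1: "is_tree A E1" and 2: "is_tree B E2" and dis: "A \<inter> B = {}"
    and u: "u \<in> A" and v: "v \<in> B"
  defines "E \<equiv> E1 \<union> E2 \<union> {{u, v}}"
  shows "is_tree (A \<union> B) E" "adj E u v" "side E u v = A" "branch E u v = E1"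
proof -
  interpret t1: tree A E1 by unfold_locales (rule 1)
  interpret t2: tree B E2 by unfold_locales (rule 2)
  have uv: "u \<noteq> v" using dis u v by blast
  show auv: "adj E u v" using uv by (auto simp: adj_def E_def)
  have adjE: "adj E x y \<longleftrightarrow> adj E1 x y \<or> adj E2 x y \<or> {x, y} = {u, v}" for x y
    using uv by (auto simp: adj_def E_def doubleton_eq_iff)
  have sideA: "side E u v \<subseteq> A"
  proof
    fix x assume "x \<in> side E u v"
    then have "reach (E - {{u, v}}) u x" by (simp add: side_def)
    then show "x \<in> A"
    proof (induction rule: rtranclp_induct)
      case (step y z)
      then show ?case using t1.edge_in[of y z] t2.edge_in[of y z] dis by (auto simp: adjE adj_Diff)
    qed (use u in simp)
  qed
  have e1: "E1 \<subseteq> E - {{u, v}}" using t1.edges_Pow dis v by (auto simp: E_def)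
  have "A \<subseteq> side E u v"
    using t1.connected[OF u] reach_mono[OF _ e1] by (auto simp: side_def)
  with sideA show side: "side E u v = A" by blast
  show "branch E u v = E1"
  proof
    show "branch E u v \<subseteq> E1"
    proof
      fix e assume "e \<in> branch E u v"
      then have e: "e \<in> E" "e \<subseteq> A" by (auto simp: branch_def side)
      have "e \<notin> E2"
      proof
        assume "e \<in> E2"
        then obtain a b where "e = {a, b}" "adj E2 a b" by (rule t2.edgeE)
        then show False using t2.edge_in[of a b] e(2) dis by blast
      qed
      with e v dis show "e \<in> E1" by (auto simp: E_def)
    qed
    show "E1 \<subseteq> branch E u v" using t1.edges_Pow e1 unfolding branch_def side by blast
  qed
  show "is_tree (A \<union> B) E"
    unfolding is_tree_def
  proof (intro conjI)
    show "finite (A \<union> B)" using t1.finite_V t2.finite_V by blast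
    show "E \<subseteq> simple_edges (A \<union> B)"
    proof -
      have "simple_edges A \<subseteq> simple_edges (A \<union> B)" "simple_edges B \<subseteq> simple_edges (A \<union> B)"
        by (auto simp: simple_edges_def)
      moreover have "{u, v} \<in> simple_edges (A \<union> B)" using u v uv by (auto simp: simple_edges_def)
      ultimately show ?thesis using 1 2 unfolding E_def is_tree_def by blast
    qed
    have "reach E u x" if "x \<in> A \<union> B" for x
    proof (cases "x \<in> A")
      case True
      then show ?thesis using t1.connected[OF u] reach_mono[of E1 u x E] by (auto simp: E_def)
    next
      case False
      then have "reach E v x" using t2.connected[OF v] that reach_mono[of E2 v x E] by (auto simp: E_def)
      then show ?thesis using auv by (rule converse_rtranclp_into_rtranclp[rotated])
    qed
    then show "connected_graph (A \<union> B) E"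
      unfolding connected_graph_def by (meson reach_sym rtranclp_trans)
    show "acyclic_graph E"
    proof (rule bridges_imp_acyclic)
      fix a b assume ab: "adj E a b"
      show "\<not> reach (E - {{a, b}}) a b"
      proof (cases "{a, b} = {u, v}")
        case True
        have "\<not> reach (E - {{u, v}}) u v" using side dis v by (auto simp: side_def)
        then show ?thesis using True reach_sym by (auto simp: doubleton_eq_iff insert_commute)
      next
        case False
        \<comment> \<open>contract the part not containing the edge to its end of the joining edge\<close>
        then consider "adj E1 a b" | "adj E2 a b" using ab adjE by blast
        then show ?thesis
        proof cases
          case 1
          define p where "p x = (if x \<in> A then x else u)" for x
          have "reach (E1 - {{a, b}}) (p x) (p y)" if "reach (E - {{a, b}}) x y" for x y
            using that
          proof (induction rule: rtranclp_induct)
            case (step y z)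
            have "adj (E1 - {{a, b}}) (p y) (p z) \<or> p y = p z"
              using step.hyps t1.edge_in[of y z] t2.edge_in[of y z] dis u v uv
              by (auto simp: adj_Diff adjE p_def doubleton_eq_iff)
            then show ?case using step.IH by (metis rtranclp.rtrancl_into_rtrancl)
          qed simp
          from this[of a b] show ?thesis
            using t1.bridge[OF 1] t1.edge_in[OF 1] by (auto simp: p_def)
        next
          case 2
          define p where "p x = (if x \<in> B then x else v)" for x
          have "reach (E2 - {{a, b}}) (p x) (p y)" if "reach (E - {{a, b}}) x y" for x y
            using that
          proof (induction rule: rtranclp_induct)
            case (step y z)
            have "adj (E2 - {{a, b}}) (p y) (p z) \<or> p y = p z"
              using step.hyps t1.edge_in[of y z] t2.edge_in[of y z] dis u v uv
              by (auto simp: adj_Diff adjE p_def doubleton_eq_iff)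
            then show ?case using step.IH by (metis rtranclp.rtrancl_into_rtrancl)
          qed simp
          from this[of a b] show ?thesis
            using t2.bridge[OF 2] t2.edge_in[OF 2] by (auto simp: p_def)
        qed
      qed
    qed
  qed
qed

section \<open>Light branches and the b-coloring\<close>

text \<open>The properness guard only matters outside trees, where it makes the recursion terminate.\<close>

function light :: "nat set set \<Rightarrow> nat \<Rightarrow> bool" where
  "light E r \<longleftrightarrow>
     (\<forall>c. finite E \<and> adj E r c \<and> branch E c r \<subset> E \<longrightarrow> \<not> light (branch E c r) c)"
  by pat_completeness auto
termination
  by (relation "measure (\<lambda>(E, r). card E)") (auto intro: psubset_card_mono)

declare light.simps [simp del]

text \<open>The property belongs to the tail \<open>u\<close> of the directed edge: it describes
  what \<open>v\<close> sees when looking at its neighbour \<open>u\<close>.\<close>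

definition light_towards :: "nat set set \<Rightarrow> nat \<Rightarrow> nat \<Rightarrow> bool" where
  "light_towards E u v \<longleftrightarrow> light (branch E u v) u"

definition red_edges :: "nat set set \<Rightarrow> nat set set" where
  "red_edges E = {{u, v} | u v. adj E u v \<and> light_towards E u v \<and> light_towards E v u}"

context tree
begin

lemma light_iff: "light E r \<longleftrightarrow> (\<forall>c. adj E r c \<longrightarrow> \<not> light_towards E c r)"
  using finite_E branch_psubset
  by (subst light.simps) (auto simp: light_towards_def adj_commute)

text \<open>In the branch, \<open>u\<close> keeps all its neighbours except \<open>v\<close>, and a
  branch of the branch is a branch of \<open>E\<close> by \<open>branch_branch\<close>. Lightness
  thus becomes a relation between the directed edges of a single tree.\<close>

lemma light_towards_iff:
  assumes uv: "adj E u v"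
  shows "light_towards E u v \<longleftrightarrow> (\<forall>w. adj E u w \<and> w \<noteq> v \<longrightarrow> \<not> light_towards E w u)"
proof -
  interpret b: tree "side E u v" "branch E u v"
    by unfold_locales (rule tree_branch, use edge_in[OF uv] in blast)
  have "adj (branch E u v) u w \<longleftrightarrow> adj E u w \<and> w \<noteq> v" for w
    using not_in_side[OF uv] side_step[OF side_self, of E u w v] uv
    by (auto simp: adj_branch doubleton_eq_iff)
  moreover have "light_towards (branch E u v) w u \<longleftrightarrow> light_towards E w u"
    if "adj E u w" "w \<noteq> v" for w
    using branch_branch[OF uv that] by (simp add: light_towards_def)
  ultimately show ?thesis
    unfolding light_towards_def[of E u v] b.light_iff by blast
qed

text \<open>Singling out one neighbour \<open>c\<close> splits lightness of the root into a
  condition on each of the two parts of the cut, as \<open>pointed_recurrence\<close>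
  demands.\<close>

lemma light_split:
  assumes "adj E r c"
  shows "light E r \<longleftrightarrow> light_towards E r c \<and> \<not> light_towards E c r"
  using assms light_iff light_towards_iff by blast

lemma Union_red_edges:
  "\<Union> (red_edges E) = {u. \<exists>v. adj E u v \<and> light_towards E u v \<and> light_towards E v u}"
proof -
  have "e \<in> red_edges E \<longleftrightarrow> (\<exists>u v. e = {u, v} \<and> adj E u v \<and> light_towards E u v \<and> light_towards E v u)" for e
    by (auto simp: red_edges_def)
  then show ?thesis using adj_commute[of E] by (intro equalityI subsetI) (auto, blast+)
qed

lemma brown_condition_iff:
  "card {e \<in> E. b \<in> e \<and> (\<exists>g\<in>G. e = {b, g})} \<ge> 2 \<longleftrightarrow>
     (\<exists>g h. g \<noteq> h \<and> g \<in> G \<and> h \<in> G \<and> adj E b g \<and> adj E b h)"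
proof -
  have eq: "{e \<in> E. b \<in> e \<and> (\<exists>g\<in>G. e = {b, g})} = (\<lambda>g. {b, g}) ` {g \<in> G. adj E b g}"
  proof -
    have "{b, g} \<in> E \<longleftrightarrow> adj E b g" for g
      using edgeE[of "{b, g}"] by (auto simp: adj_def doubleton_eq_iff)
    then show ?thesis by blast
  qed
  have inj: "inj_on (\<lambda>g. {b, g}) {g \<in> G. adj E b g}"
    by (auto simp: inj_on_def doubleton_eq_iff)
  have fin: "finite {g \<in> G. adj E b g}"
    by (rule finite_subset[OF _ finite_V]) (use edge_in in blast)
  have "card {g \<in> G. adj E b g} \<ge> 2 \<longleftrightarrow>
     (\<exists>g h. g \<noteq> h \<and> g \<in> G \<and> h \<in> G \<and> adj E b g \<and> adj E b h)" (is "?l \<longleftrightarrow> ?r")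
  proof
    assume ?l
    then obtain T where "T \<subseteq> {g \<in> G. adj E b g}" "card T = 2"
      by (meson obtain_subset_with_card_n)
    then show ?r by (auto simp: card_2_iff)
  next
    assume ?r
    then obtain g h where "g \<noteq> h" "{g, h} \<subseteq> {g \<in> G. adj E b g}" by auto
    then show ?l using card_mono[OF fin, of "{g, h}"] by simp
  qed
  then show ?thesis unfolding eq card_image[OF inj] .
qed

lemma is_bcoloring_iff:
  "is_bcoloring V E B R G \<longleftrightarrow>
     B \<subseteq> V \<and> G \<subseteq> V \<and> R \<subseteq> E \<and>
     B \<inter> G = {} \<and> B \<inter> \<Union>R = {} \<and> G \<inter> \<Union>R = {} \<and> B \<union> G \<union> \<Union>R = V \<and>
     (\<forall>e\<in>R. \<forall>f\<in>R. e \<noteq> f \<longrightarrow> e \<inter> f = {}) \<and>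
     (\<forall>u v. adj E u v \<and> u \<in> G \<longrightarrow> v \<in> B) \<and>
     (\<forall>b\<in>B. \<exists>g h. g \<noteq> h \<and> g \<in> G \<and> h \<in> G \<and> adj E b g \<and> adj E b h)"
  unfolding is_bcoloring_def brown_condition_iff by (simp add: adj_def)

lemma is_bcoloringD:
  assumes "is_bcoloring V E B R G"
  shows "B \<union> G \<union> \<Union>R = V" "R \<subseteq> E" "B \<inter> G = {}" "B \<inter> \<Union>R = {}" "G \<inter> \<Union>R = {}"
    and "\<And>e f. e \<in> R \<Longrightarrow> f \<in> R \<Longrightarrow> e \<inter> f \<noteq> {} \<Longrightarrow> e = f"
    and "\<And>u v. adj E u v \<Longrightarrow> u \<in> G \<Longrightarrow> v \<in> B"
    and "\<And>b. b \<in> B \<Longrightarrow> \<exists>g h. g \<noteq> h \<and> g \<in> G \<and> h \<in> G \<and> adj E b g \<and> adj E b h"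
  using assms unfolding is_bcoloring_iff by (elim conjE, (assumption | (simp; fail) | blast))+

text \<open>The existence half. By \<open>light_towards_iff\<close>, \<open>u\<close> is light
  towards \<open>v\<close> exactly if no other neighbour of \<open>u\<close> is light towards
  \<open>u\<close>; all conditions then follow by comparing light neighbours.\<close>

lemma is_bcoloring_light:
  "is_bcoloring V E (V - {u \<in> V. light E u} - \<Union> (red_edges E)) (red_edges E) {u \<in> V. light E u}"
proof -
  have red_unique: "v = w" if "adj E u v" "light_towards E u v" "light_towards E v u"
      "adj E u w" "light_towards E u w" "light_towards E w u" for u v w
    using that light_towards_iff by blast
  \<comment> \<open>Such a \<open>b\<close> has a light neighbour \<open>g\<close>, since it is not
    light. As the edge to \<open>g\<close> is not red, \<open>b\<close> is not light towards
    \<open>g\<close>, which must be due to a second light neighbour.\<close>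
  have two: "\<exists>g h. g \<noteq> h \<and> adj E b g \<and> adj E b h \<and> light_towards E g b \<and> light_towards E h b"
    if b: "b \<in> V - {u \<in> V. light E u} - \<Union> (red_edges E)" for b
  proof -
    obtain g where g: "adj E b g" "light_towards E g b" using b light_iff[of b] by blast
    then have "\<not> light_towards E b g" using b Union_red_edges by blast
    then show ?thesis using light_towards_iff g by blast
  qed
  \<comment> \<open>The other light neighbour \<open>h\<close> prevents \<open>b\<close> from being
    light towards \<open>g\<close>, so \<open>g\<close> is light seen from \<open>b\<close> but does
    not see \<open>b\<close> as light; by \<open>light_split\<close> it is green.\<close>
  have green: "g \<in> V \<and> light E g" if g: "g \<noteq> h" "adj E b g" "adj E b h" "light_towards E g b" "light_towards E h b"
    for b g h
  proof -
    have "\<not> light_towards E b g" using g light_towards_iff[of b g] by blast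
    moreover have "adj E g b" using g by (simp add: adj_commute)
    ultimately show ?thesis using light_split g edge_in by blast
  qed
  show ?thesis
    unfolding is_bcoloring_iff
  proof (intro conjI ballI allI impI)
    show "red_edges E \<subseteq> E" by (auto simp: red_edges_def adj_def)
    show "{u \<in> V. light E u} \<inter> \<Union> (red_edges E) = {}"
      using Union_red_edges light_iff by blast
    then show "V - {u \<in> V. light E u} - \<Union> (red_edges E) \<union> {u \<in> V. light E u} \<union> \<Union> (red_edges E) = V"
      using Union_red_edges edge_in by blast
  next
    fix e f assume e: "e \<in> red_edges E" "f \<in> red_edges E" "e \<noteq> f"
    show "e \<inter> f = {}"
    proof (rule ccontr)
      assume "e \<inter> f \<noteq> {}"
      then obtain x where x: "x \<in> e" "x \<in> f" by blast
      have "\<exists>y. e = {x, y} \<and> adj E x y \<and> light_towards E x y \<and> light_towards E y x"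
        if "x \<in> e" "e \<in> red_edges E" for e
        using that adj_commute[of E] by (force simp: red_edges_def)
      from this[OF x(1) e(1)] this[OF x(2) e(2)] show False
        using e(3) red_unique[of x] by blast
    qed
  next
    fix u v assume uv: "adj E u v \<and> u \<in> {u \<in> V. light E u}"
    then have *: "light_towards E u v" "\<not> light_towards E v u" using light_split by blast+
    have vu: "adj E v u" using uv by (simp add: adj_commute)
    obtain w where w: "adj E v w" "w \<noteq> u" "light_towards E w v"
      using * light_towards_iff[OF vu] by blast
    have "\<not> light E v" using light_iff w by blast
    moreover have "v \<notin> \<Union> (red_edges E)"
      unfolding Union_red_edges using * vu light_towards_iff w by blast
    moreover have "v \<in> V" using edge_in[of u v] uv by blast
    ultimately show "v \<in> V - {u \<in> V. light E u} - \<Union> (red_edges E)" by simp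
  next
    fix b assume "b \<in> V - {u \<in> V. light E u} - \<Union> (red_edges E)"
    then obtain g h where "g \<noteq> h" "adj E b g" "adj E b h" "light_towards E g b" "light_towards E h b"
      using two by blast
    then show "\<exists>g h. g \<noteq> h \<and> g \<in> {u \<in> V. light E u} \<and> h \<in> {u \<in> V. light E u} \<and> adj E b g \<and> adj E b h"
      using green[of g h b] green[of h g b] by blast
  qed auto
qed

text \<open>The core of uniqueness: every b-coloring already determines, from the leaves inwards,
  which directed edges are light. The induction runs over the size of the component at the
  tail.\<close>

lemma light_towards_bcoloring:
  assumes bc: "is_bcoloring V E B R G" and "adj E u v"
  shows "light_towards E u v \<longleftrightarrow> u \<in> G \<or> {u, v} \<in> R"
  using assms(2)
proof (induction "card (side E u v)" arbitrary: u v rule: less_induct)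
  case less
  note uv = \<open>adj E u v\<close>
  note D = is_bcoloringD[OF bc]
  have u: "u \<in> V" using edge_in[OF uv] by blast
  have "light_towards E w u \<longleftrightarrow> w \<in> G \<or> {u, w} \<in> R" if w: "adj E u w" "w \<noteq> v" for w
  proof -
    have "side E w u \<subset> side E u v" using side_side_subset[OF uv w] side_self by blast
    then have "card (side E w u) < card (side E u v)"
      using finite_side[OF u] psubset_card_mono by blast
    then show ?thesis using less.hyps[of w u] w by (simp add: adj_commute insert_commute)
  qed
  then have *: "light_towards E u v \<longleftrightarrow> (\<forall>w. adj E u w \<and> w \<noteq> v \<longrightarrow> w \<notin> G \<and> {u, w} \<notin> R)"
    using light_towards_iff[OF uv] by blast
  show ?case
  proof
    assume l: "light_towards E u v"
    show "u \<in> G \<or> {u, v} \<in> R"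
    proof (rule ccontr)
      assume n: "\<not> (u \<in> G \<or> {u, v} \<in> R)"
      \<comment> \<open>A brown \<open>u\<close> has two green neighbours, one of them different
        from \<open>v\<close>; a red \<open>u\<close> not matched to \<open>v\<close> has its
        partner elsewhere. Either neighbour is light towards \<open>u\<close> and contradicts
        \<open>l\<close>.\<close>
      then consider "u \<in> B" | e where "e \<in> R" "u \<in> e" using D(1) u by blast
      then show False
      proof cases
        case 1
        then show False using D(8)[OF 1] l * by blast
      next
        case 2
        then obtain a b where "e = {a, b}" "adj E a b" using edgeE[of e] D(2) by blast
        then have "\<exists>w. e = {u, w} \<and> adj E u w"
          using 2 by (auto simp: insert_commute adj_commute)
        then show False using l * n 2 by blast
      qed
    qed
  next
    assume r: "u \<in> G \<or> {u, v} \<in> R"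
    have "w \<notin> G \<and> {u, w} \<notin> R" if w: "adj E u w" "w \<noteq> v" for w
    proof (cases "u \<in> G")
      case True
      then show ?thesis using D(3,5) D(7)[OF w(1)] by blast
    next
      case False
      then have uvR: "{u, v} \<in> R" using r by blast
      then have "u \<notin> B" using D(4) by blast
      then have "w \<notin> G" using D(7)[of w u] w by (auto simp: adj_commute)
      moreover have "{u, w} \<noteq> {u, v}" using w by (auto simp: doubleton_eq_iff)
      then have "{u, w} \<notin> R" using D(6)[OF uvR, of "{u, w}"] by auto
      ultimately show ?thesis by blast
    qed
    then show "light_towards E u v" using * by blast
  qed
qed

lemma is_bcoloring_unique:
  assumes bc: "is_bcoloring V E B R G"
  shows "G = {u \<in> V. light E u}" "R = red_edges E" "B = V - {u \<in> V. light E u} - \<Union> (red_edges E)"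
proof -
  note D = is_bcoloringD[OF bc]
  note key = light_towards_bcoloring[OF bc]
  have R: "e \<in> R \<Longrightarrow> \<exists>u v. e = {u, v} \<and> adj E u v" for e using edgeE[of e] D(2) by blast
  have light: "light E u \<longleftrightarrow> (\<forall>w. adj E u w \<longrightarrow> w \<notin> G \<and> {u, w} \<notin> R)" for u
    unfolding light_iff using key adj_commute insert_commute by metis
  show G: "G = {u \<in> V. light E u}"
  proof (intro equalityI subsetI)
    fix u assume u: "u \<in> G"
    then show "u \<in> {u \<in> V. light E u}" unfolding mem_Collect_eq light using D(1,3,5,7) by blast
  next
    fix u assume u: "u \<in> {u \<in> V. light E u}"
    have "u \<notin> B" using D(8)[of u] u unfolding mem_Collect_eq light by blast
    moreover have "u \<notin> \<Union> R"
    proof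
      assume "u \<in> \<Union> R"
      then obtain a b where "{a, b} \<in> R" "adj E a b" "u \<in> {a, b}" using R by blast
      then show False using u unfolding mem_Collect_eq light
        by (auto simp: insert_commute adj_commute)
    qed
    ultimately show "u \<in> G" using D(1) u by blast
  qed
  show R: "R = red_edges E"
  proof (intro equalityI subsetI)
    fix e assume e: "e \<in> R"
    then obtain u v where uv: "e = {u, v}" "adj E u v" using R by blast
    have "adj E v u" "{v, u} \<in> R" using uv e by (simp_all add: adj_commute insert_commute)
    then show "e \<in> red_edges E" using key uv e unfolding red_edges_def by blast
  next
    fix e assume "e \<in> red_edges E"
    then obtain u v where uv: "e = {u, v}" "adj E u v" "light_towards E u v" "light_towards E v u"
      by (auto simp: red_edges_def)
    have vu: "adj E v u" using uv by (simp add: adj_commute)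
    show "e \<in> R"
    proof (rule ccontr)
      assume "e \<notin> R"
      then have "u \<in> G" "v \<in> G" using key[OF uv(2)] key[OF vu] uv by (auto simp: insert_commute)
      then show False using D(3) D(7)[OF uv(2)] by blast
    qed
  qed
  show "B = V - {u \<in> V. light E u} - \<Union> (red_edges E)"
    using D(1,3,4) unfolding G[symmetric] R[symmetric] by blast
qed

lemma bcoloring_eq:
  "bcoloring V E =
     (V - {u \<in> V. light E u} - \<Union> (red_edges E), red_edges E, {u \<in> V. light E u})"
  unfolding bcoloring_def
proof (rule the_equality)
  show "case (V - {u \<in> V. light E u} - \<Union> (red_edges E), red_edges E, {u \<in> V. light E u}) of
      (B, R, G) \<Rightarrow> is_bcoloring V E B R G"
    using is_bcoloring_light by simp
next
  fix x assume "case x of (B, R, G) \<Rightarrow> is_bcoloring V E B R G"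
  then show "x = (V - {u \<in> V. light E u} - \<Union> (red_edges E), red_edges E, {u \<in> V. light E u})"
    using is_bcoloring_unique by (cases x) simp
qed

lemma green_eq: "green V E = {u \<in> V. light E u}"
  by (simp add: green_def bcoloring_eq)

lemma red_eq: "red V E = {u. \<exists>v. adj E u v \<and> light_towards E u v \<and> light_towards E v u}"
  by (simp add: red_def bcoloring_eq Union_red_edges)

lemma card_colors: "card (brown V E) + card (red V E) + card (green V E) = card V"
proof -
  have V: "V = brown V E \<union> red V E \<union> green V E" "brown V E \<inter> red V E = {}"
    "(brown V E \<union> red V E) \<inter> green V E = {}"
    using is_bcoloringD(1,3,4,5)[OF is_bcoloring_light]
    unfolding brown_def red_def green_def bcoloring_eq fst_conv snd_conv by blast+
  have "finite (brown V E)" "finite (red V E)" "finite (green V E)"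
    using finite_V V(1) by (metis finite_Un)+
  then have "card (brown V E \<union> red V E \<union> green V E) = card (brown V E) + card (red V E) + card (green V E)"
    using V(2,3) by (simp add: card_Un_disjoint)
  with V(1) show ?thesis by simp
qed

text \<open>A red vertex has exactly one partner, so red vertices correspond to red edges directed
  away from them. In this form cutting at a directed edge applies.\<close>

lemma card_red:
  "card (red V E) = card {(u, v). adj E u v \<and> light_towards E u v \<and> light_towards E v u}" (is "_ = card ?D")
proof -
  have "red V E = fst ` ?D" by (force simp: red_eq)
  moreover have "inj_on fst ?D"
  proof (rule inj_onI)
    fix p q assume "p \<in> ?D" "q \<in> ?D" "fst p = fst q"
    then show "p = q" using light_towards_iff by (cases p, cases q) fastforce
  qed
  ultimately show ?thesis by (simp add: card_image)
qed

end

section \<open>Counting rooted trees\<close>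

definition rooted_trees :: "nat set \<Rightarrow> (nat set set \<times> nat) set" where
  "rooted_trees V = {(E, r). is_tree V E \<and> r \<in> V}"

definition light_trees :: "nat set \<Rightarrow> (nat set set \<times> nat) set" where
  "light_trees V = {(E, r). is_tree V E \<and> r \<in> V \<and> light E r}"

definition directed_edges :: "nat set \<Rightarrow> (nat set set \<times> nat \<times> nat) set" where
  "directed_edges V = {(E, u, v). is_tree V E \<and> adj E u v}"

lemma finite_trees: "finite V \<Longrightarrow> finite {E. is_tree V E}"
  by (rule finite_subset[of _ "Pow (Pow V)"]) (auto simp: is_tree_def simple_edges_def)

lemma finite_rooted_trees: "finite V \<Longrightarrow> finite (rooted_trees V)"
  by (rule finite_subset[of _ "{E. is_tree V E} \<times> V"]) (auto simp: rooted_trees_def finite_trees)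

lemma rooted_trees_empty [simp]: "rooted_trees {} = {}"
  by (simp add: rooted_trees_def)

lemma light_trees_subset: "light_trees V \<subseteq> rooted_trees V"
  by (auto simp: light_trees_def rooted_trees_def)

lemma finite_light_trees: "finite V \<Longrightarrow> finite (light_trees V)"
  by (rule finite_subset[OF light_trees_subset finite_rooted_trees])

text \<open>Cutting (\<open>j\<close>) and joining (\<open>i\<close>) are mutually inverse. The
  weight \<open>F\<close> also receives the two vertex sets, since the recurrences weight by the
  size of a component.\<close>

lemma sum_directed_edges:
  fixes F :: "nat set \<Rightarrow> nat set set \<times> nat \<Rightarrow> nat set \<Rightarrow> nat set set \<times> nat \<Rightarrow> nat"
  assumes "finite V"
  shows "(\<Sum>(E, u, v)\<in>directed_edges V. F (side E u v) (branch E u v, u) (side E v u) (branch E v u, v))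
    = (\<Sum>A\<in>Pow V. \<Sum>p\<in>rooted_trees A. \<Sum>q\<in>rooted_trees (V - A). F A p (V - A) q)"
proof -
  have fin: "finite A" if "A \<in> Pow V" for A using that assms finite_subset by blast
  define S where "S = Sigma (Pow V) (\<lambda>A. rooted_trees A \<times> rooted_trees (V - A))"
  define i where "i = (\<lambda>(A :: nat set, (E1, u), (E2, v)). (E1 \<union> E2 \<union> {{u, v}}, u :: nat, v :: nat))"
  define j where "j = (\<lambda>(E, u, v). (side E u v, (branch E u v, u), (branch E v u, v)))"
  have i: "i x \<in> directed_edges V \<and> j (i x) = x" if x: "x \<in> S" for x
  proof -
    obtain A E1 u E2 v where x_eq: "x = (A, (E1, u), (E2, v))"
      by (metis prod.exhaust)
    have A: "A \<subseteq> V" "is_tree A E1" "u \<in> A" "is_tree (V - A) E2" "v \<in> V - A"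
      using x by (auto simp: x_eq S_def rooted_trees_def)
    define E where "E = E1 \<union> E2 \<union> {{u, v}}"
    have E': "E = E2 \<union> E1 \<union> {{v, u}}" unfolding E_def by blast
    have dis: "A \<inter> (V - A) = {}" "(V - A) \<inter> A = {}" by blast+
    have AV: "A \<union> (V - A) = V" using A by blast
    have 1: "is_tree V E" "adj E u v" "side E u v = A" "branch E u v = E1"
      using is_tree_join[OF A(2,4) dis(1) A(3,5)] unfolding E_def[symmetric] AV by blast+
    have 2: "branch E v u = E2"
      unfolding E' by (rule is_tree_join(4)[OF A(4,2) dis(2) A(5,3)])
    have "i x = (E, u, v)" by (simp add: x_eq i_def E_def)
    then show ?thesis using 1 2 by (simp add: x_eq j_def directed_edges_def)
  qed
  have j: "j y \<in> S \<and> i (j y) = y" if y: "y \<in> directed_edges V" for y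
  proof -
    obtain E u v where y_eq: "y = (E, u, v)" by (metis prod.exhaust)
    have uv: "adj E u v" and vu: "adj E v u"
      using y by (auto simp: y_eq directed_edges_def adj_commute)
    interpret tree V E using y by unfold_locales (simp add: y_eq directed_edges_def)
    have "V - side E u v = side E v u" "side E u v \<subseteq> V"
      using side_Un[OF uv] side_disjoint[OF uv] by blast+
    then show ?thesis
      using tree_branch edge_in[OF uv] edge_split[OF uv] not_in_side[OF uv]
      by (simp add: y_eq i_def j_def S_def rooted_trees_def)
  qed
  have "(\<Sum>(E, u, v)\<in>directed_edges V. F (side E u v) (branch E u v, u) (side E v u) (branch E v u, v))
    = (\<Sum>(A, p, q)\<in>S. F A p (V - A) q)"
  proof (rule sum.reindex_bij_witness[of _ i j])
    fix y assume y: "y \<in> directed_edges V"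
    obtain E u v where y_eq: "y = (E, u, v)" by (metis prod.exhaust)
    interpret tree V E using y by unfold_locales (simp add: y_eq directed_edges_def)
    have uv: "adj E u v" using y by (simp add: y_eq directed_edges_def)
    have "V - side E u v = side E v u"
      using side_Un[OF uv] side_disjoint[OF uv] by blast
    then show "(case j y of (A, p, q) \<Rightarrow> F A p (V - A) q)
      = (case y of (E, u, v) \<Rightarrow> F (side E u v) (branch E u v, u) (side E v u) (branch E v u, v))"
      by (simp add: y_eq j_def)
  qed (use i j in blast)+
  also have "\<dots> = (\<Sum>A\<in>Pow V. \<Sum>(p, q)\<in>rooted_trees A \<times> rooted_trees (V - A). F A p (V - A) q)"
    unfolding S_def using fin assms by (subst sum.Sigma) (auto simp: finite_rooted_trees)
  also have "\<dots> = (\<Sum>A\<in>Pow V. \<Sum>p\<in>rooted_trees A. \<Sum>q\<in>rooted_trees (V - A). F A p (V - A) q)"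
    by (simp only: sum.cartesian_product)
  finally show ?thesis .
qed

lemma sum_directed_edges_root:
  assumes "finite V"
  shows "(\<Sum>(E, u, v)\<in>directed_edges V. f E u v) = (\<Sum>(E, u)\<in>rooted_trees V. \<Sum>v\<in>{v. adj E u v}. f E u v)"
proof -
  have eq: "directed_edges V = (\<lambda>((E, u), v). (E, u, v)) ` Sigma (rooted_trees V) (\<lambda>(E, u). {v. adj E u v})"
    using tree.edge_in[OF tree.intro]
    by (force simp: directed_edges_def rooted_trees_def image_iff)
  have inj: "inj_on (\<lambda>((E, u), v). (E, u, v)) (Sigma (rooted_trees V) (\<lambda>(E, u). {v. adj E u v}))"
    by (auto simp: inj_on_def)
  have fin: "finite (case p of (E, u) \<Rightarrow> {v. adj E u v})" if "p \<in> rooted_trees V" for p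
  proof (rule finite_subset[OF _ assms])
    show "(case p of (E, u) \<Rightarrow> {v. adj E u v}) \<subseteq> V"
      using that tree.edge_in[OF tree.intro, of V] by (auto simp: rooted_trees_def)
  qed
  have "(\<Sum>(E, u)\<in>rooted_trees V. \<Sum>v\<in>{v. adj E u v}. f E u v) =
    (\<Sum>p\<in>rooted_trees V. \<Sum>v\<in>(case p of (E, u) \<Rightarrow> {v. adj E u v}). f (fst p) (snd p) v)"
    by (simp add: case_prod_unfold)
  also have "\<dots> = (\<Sum>(p, v)\<in>Sigma (rooted_trees V) (\<lambda>(E, u). {v. adj E u v}). f (fst p) (snd p) v)"
    using fin by (intro sum.Sigma finite_rooted_trees[OF assms]) auto
  finally show ?thesis
    unfolding eq sum.reindex[OF inj] by (simp add: case_prod_unfold)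
qed

text \<open>The left side counts trees with property \<open>P\<close> and a second marked vertex
  other than the root. The path to that vertex starts with a unique edge; cutting there leaves a
  rooted tree and a rooted tree with a marked vertex, whence the factor
  \<open>card (V - A)\<close>.\<close>

lemma pointed_recurrence:
  assumes V: "finite V"
    and P: "\<And>E r c. is_tree V E \<Longrightarrow> adj E r c \<Longrightarrow>
      P (E, r) \<longleftrightarrow> Q (branch E r c, r) \<and> S (branch E c r, c)"
  shows "(card V - 1) * card {p \<in> rooted_trees V. P p} =
    (\<Sum>A\<in>Pow V. card {p \<in> rooted_trees A. Q p} * (card (V - A) * card {q \<in> rooted_trees (V - A). S q}))"
proof -
  have "(card V - 1) * card {p \<in> rooted_trees V. P p}
      = (\<Sum>p\<in>rooted_trees V. if P p then card V - 1 else 0)"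
    using finite_rooted_trees[OF V] by (simp add: sum.inter_filter[symmetric])
  also have "\<dots> = (\<Sum>(E, r)\<in>rooted_trees V. \<Sum>c\<in>{c. adj E r c}. if P (E, r) then card (side E c r) else 0)"
  proof (intro sum.cong refl, clarify)
    fix E r assume Er: "(E, r) \<in> rooted_trees V"
    interpret tree V E using Er by unfold_locales (simp add: rooted_trees_def)
    have r: "r \<in> V" using Er by (simp add: rooted_trees_def)
    have "card V - 1 = card (V - {r})" using V r by simp
    also have "\<dots> = (\<Sum>c\<in>{c. adj E r c}. card (side E c r))"
      unfolding sides_cover[OF r, symmetric]
    proof (rule card_UN_disjoint)
      show "finite {c. adj E r c}" by (rule finite_subset[OF _ V]) (use edge_in in blast)
      show "\<forall>c\<in>{c. adj E r c}. finite (side E c r)" using finite_side edge_in by blast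
      show "\<forall>c\<in>{c. adj E r c}. \<forall>d\<in>{c. adj E r c}. c \<noteq> d \<longrightarrow> side E c r \<inter> side E d r = {}"
        using sides_disjoint by blast
    qed
    finally show "(if P (E, r) then card V - 1 else 0)
      = (\<Sum>c\<in>{c. adj E r c}. if P (E, r) then card (side E c r) else 0)" by simp
  qed
  also have "\<dots> = (\<Sum>(E, r, c)\<in>directed_edges V. if P (E, r) then card (side E c r) else 0)"
    using sum_directed_edges_root[OF V, of "\<lambda>E r c. if P (E, r) then card (side E c r) else 0"] by simp
  also have "\<dots> = (\<Sum>(E, r, c)\<in>directed_edges V.
      if Q (branch E r c, r) \<and> S (branch E c r, c) then card (side E c r) else 0)"
    by (intro sum.cong refl) (auto simp: directed_edges_def P)
  also have "\<dots> = (\<Sum>A\<in>Pow V. \<Sum>p\<in>rooted_trees A. \<Sum>q\<in>rooted_trees (V - A).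
      if Q p \<and> S q then card (V - A) else 0)"
    by (rule sum_directed_edges[OF V, of "\<lambda>A p B q. if Q p \<and> S q then card B else 0"])
  also have "\<dots> = (\<Sum>A\<in>Pow V. card {p \<in> rooted_trees A. Q p} * (card (V - A) * card {q \<in> rooted_trees (V - A). S q}))"
  proof (intro sum.cong refl)
    fix A assume "A \<in> Pow V"
    then have fin: "finite (rooted_trees A)" "finite (rooted_trees (V - A))"
      using V finite_subset finite_rooted_trees by auto
    have *: "(\<Sum>q\<in>rooted_trees (V - A). if Q p \<and> S q then card (V - A) else 0)
      = (if Q p then card (V - A) * card {q \<in> rooted_trees (V - A). S q} else 0)" for p
      using fin by (simp add: sum.inter_filter[symmetric])
    show "(\<Sum>p\<in>rooted_trees A. \<Sum>q\<in>rooted_trees (V - A). if Q p \<and> S q then card (V - A) else 0)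
      = card {p \<in> rooted_trees A. Q p} * (card (V - A) * card {q \<in> rooted_trees (V - A). S q})"
      unfolding * using fin by (simp add: sum.inter_filter[symmetric])
  qed
  finally show ?thesis .
qed

lemma rooted_recurrence:
  assumes "finite V"
  shows "(card V - 1) * card (rooted_trees V) =
    (\<Sum>A\<in>Pow V. card (rooted_trees A) * (card (V - A) * card (rooted_trees (V - A))))"
  using pointed_recurrence[OF assms, of "\<lambda>_. True" "\<lambda>_. True" "\<lambda>_. True"] by simp

text \<open>By \<open>light_split\<close> the part at the root is again light while the branch cut
  off is not, hence the difference of the two counts.\<close>

lemma light_recurrence:
  assumes V: "finite V"
  shows "(card V - 1) * card (light_trees V) =
    (\<Sum>A\<in>Pow V. card (light_trees A) *
       (card (V - A) * (card (rooted_trees (V - A)) - card (light_trees (V - A)))))"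
proof -
  have l: "{p \<in> rooted_trees A. case_prod light p} = light_trees A" for A
    by (auto simp: rooted_trees_def light_trees_def)
  have d: "card {p \<in> rooted_trees A. \<not> case_prod light p} = card (rooted_trees A) - card (light_trees A)"
    if "finite A" for A
    using card_Diff_subset[OF finite_light_trees[OF that] light_trees_subset]
    by (rule trans[rotated]) (auto simp: rooted_trees_def light_trees_def intro: arg_cong[where f = card])
  show ?thesis
    using pointed_recurrence[OF V, of "case_prod light" "case_prod light" "\<lambda>p. \<not> case_prod light p"]
      tree.light_split[OF tree.intro] V
    by (simp add: l d light_towards_def)
qed

section \<open>Counts depending only on the number of vertices\<close>

definition rooted_count :: "nat \<Rightarrow> nat" where
  "rooted_count n = card (rooted_trees {1..n})"

definition light_count :: "nat \<Rightarrow> nat" where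
  "light_count n = card (light_trees {1..n})"

lemma sum_Pow_card:
  assumes "finite V"
  shows "(\<Sum>A\<in>Pow V. f (card A)) = (\<Sum>k\<le>card V. (card V choose k) * (f k :: nat))"
proof -
  have "(\<Sum>A\<in>Pow V. f (card A)) = (\<Sum>k\<le>card V. \<Sum>A\<in>{A \<in> Pow V. card A = k}. f (card A))"
    using assms by (intro sum.group[symmetric]) (auto intro: card_mono)
  also have "\<dots> = (\<Sum>k\<le>card V. (card V choose k) * f k)"
    using n_subsets[OF assms] by (intro sum.cong refl) simp
  finally show ?thesis .
qed

lemma trees_singleton: "rooted_trees {x} = {({}, x)}" "light_trees {x} = {({}, x)}"
proof -
  have "is_tree {x} E \<longleftrightarrow> E = {}" for E
    by (auto simp: is_tree_def simple_edges_def connected_graph_def acyclic_graph_def is_cycle_def adj_def)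
  moreover have "light {} x" by (subst light.simps) (simp add: adj_def)
  ultimately show "rooted_trees {x} = {({}, x)}" "light_trees {x} = {({}, x)}"
    by (auto simp: rooted_trees_def light_trees_def)
qed

lemma light_trees_empty [simp]: "light_trees {} = {}"
  by (simp add: light_trees_def)

lemma count_0 [simp]: "rooted_count 0 = 0" "light_count 0 = 0"
  by (simp_all add: rooted_count_def light_count_def)

text \<open>The recurrences determine both cardinalities from those of smaller vertex sets, so
  strong induction shows that only the size of \<open>V\<close> matters; no trees are
  relabelled.\<close>

lemma card_trees:
  "finite V \<Longrightarrow> card (rooted_trees V) = rooted_count (card V) \<and> card (light_trees V) = light_count (card V)"
proof (induction "card V" arbitrary: V rule: less_induct)
  case less
  define n where "n = card V"
  have rec: "(n - 1) * card (rooted_trees W) =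
        (\<Sum>k\<le>n. (n choose k) * (rooted_count k * ((n - k) * rooted_count (n - k))))
      \<and> (n - 1) * card (light_trees W) =
        (\<Sum>k\<le>n. (n choose k) * (light_count k * ((n - k) * (rooted_count (n - k) - light_count (n - k)))))"
    if W: "finite W" "card W = n" for W
  proof -
    have IH: "card (rooted_trees A) = rooted_count (card A) \<and> card (light_trees A) = light_count (card A)"
      if "A \<subset> W" for A
      using less.hyps[of A] that W psubset_card_mono[OF W(1) that] finite_subset[of A W]
      by (auto simp: n_def)
    have cD: "card (W - A) = n - card A" if "A \<subseteq> W" for A
      using W that by (simp add: card_Diff_subset finite_subset)
    have IH': "card (rooted_trees A) = rooted_count (card A) \<and> card (light_trees A) = light_count (card A)
        \<and> card (rooted_trees (W - A)) = rooted_count (n - card A)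
        \<and> card (light_trees (W - A)) = light_count (n - card A)"
      if "A \<noteq> {}" "A \<subset> W" for A
      using IH[of A] IH[of "W - A"] that cD[of A] by auto
    \<comment> \<open>For \<open>A = {}\<close> and \<open>A = W\<close> one factor on each side
      counts trees on the empty set and vanishes, so only proper nonempty subsets call for the
      induction hypothesis.\<close>
    have 1: "card (rooted_trees A) * (card (W - A) * card (rooted_trees (W - A)))
        = rooted_count (card A) * ((n - card A) * rooted_count (n - card A))" if "A \<in> Pow W" for A
      using that IH'[of A] cD[of A] W(2) by (cases "A = {} \<or> A = W") (auto simp: psubset_eq)
    have 2: "card (light_trees A) * (card (W - A) * (card (rooted_trees (W - A)) - card (light_trees (W - A))))
        = light_count (card A) * ((n - card A) * (rooted_count (n - card A) - light_count (n - card A)))"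
      if "A \<in> Pow W" for A
      using that IH'[of A] cD[of A] W(2) by (cases "A = {} \<or> A = W") (auto simp: psubset_eq)
    show ?thesis
      using trans[OF rooted_recurrence[OF W(1)] sum.cong[OF refl 1]]
        trans[OF light_recurrence[OF W(1)] sum.cong[OF refl 2]]
      unfolding sum_Pow_card[OF W(1), of "\<lambda>k. rooted_count k * ((n - k) * rooted_count (n - k))"]
        sum_Pow_card[OF W(1), of "\<lambda>k. light_count k * ((n - k) * (rooted_count (n - k) - light_count (n - k)))"]
        W(2) by blast
  qed
  \<comment> \<open>The factor \<open>n - 1\<close> can be cancelled only for \<open>n > 1\<close>;
    a single vertex is treated directly.\<close>
  consider "n = 0" | "n = 1" | "n > 1" by linarith
  then show ?case
  proof cases
    case 1
    then show ?thesis using less.prems by (simp add: n_def)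
  next
    case 2
    then obtain x where "V = {x}" unfolding n_def using card_1_singletonE by blast
    then show ?thesis by (simp add: rooted_count_def light_count_def trees_singleton)
  next
    case 3
    have "(n - 1) * card (rooted_trees V) = (n - 1) * rooted_count n"
      "(n - 1) * card (light_trees V) = (n - 1) * light_count n"
      using rec[of V] rec[of "{1..n}"] less.prems
      by (simp_all add: n_def[symmetric] rooted_count_def light_count_def)
    then show ?thesis using 3 by (simp add: n_def)
  qed
qed

lemma count_1: "rooted_count 1 = 1" "light_count 1 = 1"
  by (simp_all add: rooted_count_def light_count_def trees_singleton)

lemma light_count_le: "light_count n \<le> rooted_count n"
  unfolding light_count_def rooted_count_def
  by (rule card_mono[OF finite_rooted_trees light_trees_subset]) simp

lemma rooted_count_recurrence:
  "(n - 1) * rooted_count n = (\<Sum>k\<le>n. (n choose k) * (rooted_count k * ((n - k) * rooted_count (n - k))))"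
proof -
  have "(n - 1) * rooted_count n
    = (\<Sum>A\<in>Pow {1..n}. rooted_count (card A) * ((n - card A) * rooted_count (n - card A)))"
    using rooted_recurrence[of "{1..n}"] finite_subset[of _ "{1..n}"]
    by (simp add: card_trees card_Diff_subset)
  then show ?thesis
    using sum_Pow_card[of "{1..n}" "\<lambda>k. rooted_count k * ((n - k) * rooted_count (n - k))"] by simp
qed

lemma light_count_recurrence:
  "(n - 1) * light_count n = (\<Sum>k\<le>n. (n choose k) *
     (light_count k * ((n - k) * (rooted_count (n - k) - light_count (n - k)))))"
proof -
  have "(n - 1) * light_count n
    = (\<Sum>A\<in>Pow {1..n}. light_count (card A) * ((n - card A) * (rooted_count (n - card A) - light_count (n - card A))))"
    using light_recurrence[of "{1..n}"] finite_subset[of _ "{1..n}"]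
    by (simp add: card_trees card_Diff_subset)
  then show ?thesis
    using sum_Pow_card[of "{1..n}"
      "\<lambda>k. light_count k * ((n - k) * (rooted_count (n - k) - light_count (n - k)))"] by simp
qed

lemma N_G_eq: "N_G n = light_count n"
proof -
  have eq: "light_trees {1..n} = Sigma (labeled_trees n) (green {1..n})"
    by (auto simp: light_trees_def labeled_trees_def tree.green_eq tree_def)
  show ?thesis
    unfolding light_count_def eq N_G_def
    by (rule card_SigmaI[symmetric])
      (auto simp: labeled_trees_def finite_trees tree.green_eq tree_def)
qed

text \<open>By \<open>card_red\<close> the directed red edges are counted. Cutting at such an edge
  leaves an ordered pair of light rooted trees on complementary vertex sets.\<close>

lemma N_R_eq: "N_R n = (\<Sum>k\<le>n. (n choose k) * (light_count k * light_count (n - k)))"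
proof -
  let ?V = "{1..n}"
  let ?red = "\<lambda>E. {(u, v). adj E u v \<and> light_towards E u v \<and> light_towards E v u}"
  have fin: "finite (labeled_trees n)" by (simp add: labeled_trees_def finite_trees)
  have dir: "directed_edges ?V = Sigma (labeled_trees n) (\<lambda>E. {(u, v). adj E u v})"
    by (auto simp: directed_edges_def labeled_trees_def)
  have fd: "finite {(u, v). adj E u v}" if "E \<in> labeled_trees n" for E
  proof (rule finite_subset)
    show "{(u, v). adj E u v} \<subseteq> ?V \<times> ?V"
      using that tree.edge_in[OF tree.intro, of ?V E] unfolding labeled_trees_def by blast
  qed simp
  have "N_R n = (\<Sum>E\<in>labeled_trees n. card (?red E))"
    unfolding N_R_def by (intro sum.cong refl tree.card_red) (simp add: labeled_trees_def tree_def)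
  also have "\<dots> = (\<Sum>E\<in>labeled_trees n. \<Sum>(u, v)\<in>{(u, v). adj E u v}.
      if light_towards E u v \<and> light_towards E v u then 1 else 0)"
  proof (intro sum.cong refl)
    fix E assume E: "E \<in> labeled_trees n"
    have "?red E = {p \<in> {(u, v). adj E u v}. case p of (u, v) \<Rightarrow> light_towards E u v \<and> light_towards E v u}"
      by auto
    then show "card (?red E) = (\<Sum>(u, v)\<in>{(u, v). adj E u v}.
        if light_towards E u v \<and> light_towards E v u then 1 else 0)"
      using sum.inter_filter[OF fd[OF E], of "\<lambda>_. 1 :: nat"
        "\<lambda>p. case p of (u, v) \<Rightarrow> light_towards E u v \<and> light_towards E v u"]
      by (simp add: case_prod_unfold)
  qed
  also have "\<dots> = (\<Sum>(E, u, v)\<in>directed_edges ?V.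
      if light (branch E u v) u \<and> light (branch E v u) v then 1 else 0)"
    unfolding dir using fin fd
    by (subst sum.Sigma) (auto simp: case_prod_unfold light_towards_def)
  also have "\<dots> = (\<Sum>A\<in>Pow ?V. \<Sum>p\<in>rooted_trees A. \<Sum>q\<in>rooted_trees (?V - A).
      if case_prod light p \<and> case_prod light q then 1 else 0)"
    using sum_directed_edges[of ?V "\<lambda>A p B q. if case_prod light p \<and> case_prod light q then 1 else 0"]
    by simp
  also have "\<dots> = (\<Sum>A\<in>Pow ?V. light_count (card A) * light_count (n - card A))"
  proof (intro sum.cong refl)
    fix A assume A: "A \<in> Pow ?V"
    then have fA: "finite A" using finite_subset by blast
    then have fin: "finite (rooted_trees A)" "finite (rooted_trees (?V - A))"
      by (simp_all add: finite_rooted_trees)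
    have l: "{p \<in> rooted_trees A. case_prod light p} = light_trees A" for A
      by (auto simp: rooted_trees_def light_trees_def)
    have *: "(\<Sum>q\<in>rooted_trees (?V - A). if case_prod light p \<and> case_prod light q then 1 else 0)
      = (if case_prod light p then card (light_trees (?V - A)) else 0)" for p
      using fin by (simp add: sum.inter_filter[symmetric] l)
    have "(\<Sum>p\<in>rooted_trees A. \<Sum>q\<in>rooted_trees (?V - A). if case_prod light p \<and> case_prod light q then 1 else 0)
      = card (light_trees A) * card (light_trees (?V - A))"
      unfolding * using fin by (simp add: sum.inter_filter[symmetric] l)
    also have "\<dots> = light_count (card A) * light_count (n - card A)"
      using A fA by (simp add: card_trees card_Diff_subset)
    finally show "(\<Sum>p\<in>rooted_trees A. \<Sum>q\<in>rooted_trees (?V - A).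
        if case_prod light p \<and> case_prod light q then 1 else 0)
      = light_count (card A) * light_count (n - card A)" .
  qed
  also have "\<dots> = (\<Sum>k\<le>n. (n choose k) * (light_count k * light_count (n - k)))"
    using sum_Pow_card[of ?V "\<lambda>k. light_count k * light_count (n - k)"] by simp
  finally show ?thesis .
qed

lemma N_sum: "N_B n + N_R n + N_G n = rooted_count n"
proof -
  have eq: "rooted_trees {1..n} = labeled_trees n \<times> {1..n}"
    by (auto simp: rooted_trees_def labeled_trees_def)
  have "N_B n + N_R n + N_G n = (\<Sum>E\<in>labeled_trees n. card {1..n})"
    unfolding N_B_def N_R_def N_G_def sum.distrib[symmetric]
    by (intro sum.cong refl tree.card_colors) (simp add: labeled_trees_def tree_def)
  then show ?thesis unfolding rooted_count_def eq by (simp add: card_cartesian_product)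
qed

section \<open>Generating functions\<close>

lemma egf_nth: "N 0 = 0 \<Longrightarrow> egf N $ n = real (N n) / fact n"
  by (simp add: egf_def)

lemma fps_X_deriv_nth: "(fps_X * fps_deriv f) $ n = of_nat n * (f $ n :: real)"
  by (cases n) simp_all

lemma egf_mult_nth:
  assumes "M 0 = 0" "N 0 = 0"
  shows "(egf M * egf N) $ n = real (\<Sum>k\<le>n. (n choose k) * (M k * N (n - k))) / fact n"
proof -
  have "(egf M * egf N) $ n = (\<Sum>k\<le>n. egf M $ k * egf N $ (n - k))"
    by (simp add: fps_mult_nth atLeast0AtMost)
  also have "\<dots> = (\<Sum>k\<le>n. real ((n choose k) * (M k * N (n - k))) / fact n)"
    by (intro sum.cong refl) (simp add: egf_nth assms binomial_fact field_simps)
  finally show ?thesis by (simp add: sum_divide_distrib)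
qed

lemma egf_pointed:
  assumes 0: "a 0 = 0" "b 0 = 0" "c 0 = 0"
    and rec: "\<And>n. (n - 1) * c n = (\<Sum>k\<le>n. (n choose k) * (a k * ((n - k) * b (n - k))))"
  shows "fps_X * fps_deriv (egf c) = egf c + egf a * (fps_X * fps_deriv (egf b))"
proof (rule fps_ext)
  fix n
  have b: "fps_X * fps_deriv (egf b) = egf (\<lambda>n. n * b n)"
    by (rule fps_ext) (simp add: fps_X_deriv_nth egf_nth 0)
  \<comment> \<open>At \<open>n = 0\<close> the natural number \<open>n - 1\<close> is 0 rather than
    -1, which is harmless because \<open>c 0 = 0\<close>.\<close>
  have "real n * (real (c n) / fact n) - real (c n) / fact n = real ((n - 1) * c n) / fact n"
    by (cases n) (simp_all add: 0 add_divide_distrib ring_distribs)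
  also have "\<dots> = (egf a * egf (\<lambda>n. n * b n)) $ n"
    unfolding rec by (rule egf_mult_nth[symmetric]) (simp_all add: 0)
  finally show "(fps_X * fps_deriv (egf c)) $ n = (egf c + egf a * (fps_X * fps_deriv (egf b))) $ n"
    unfolding b fps_add_nth fps_X_deriv_nth egf_nth[of c, OF 0(3)] by simp
qed

lemma egf_rooted_count_ode:
  "fps_X * fps_deriv (egf rooted_count)
     = egf rooted_count + egf rooted_count * (fps_X * fps_deriv (egf rooted_count))"
  by (rule egf_pointed[OF _ _ _ rooted_count_recurrence]) simp_all

text \<open>The differential equation relates the coefficients of \<open>T ^ k\<close> to those of
  \<open>T ^ Suc k\<close>; descending from the trivial coefficient of \<open>x ^ n\<close> in \<open>T ^ n\<close> gives
  Lagrange's formula, Cayley's formula being the case \<open>k = 1\<close>.\<close>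

lemma tree_power_nth:
  fixes T :: "real fps"
  assumes ode: "fps_X * fps_deriv T = T + T * (fps_X * fps_deriv T)"
    and T0: "T $ 0 = 0" and T1: "T $ 1 = 1" and k: "1 \<le> k" "k \<le> n"
  shows "(T ^ k) $ n = real k * real n ^ (n - k) / (real n * fact (n - k))"
  using k(2,1)
proof (induction k rule: inc_induct)
  case base
  then show ?case using startsby_zero_power_nth_same[OF T0, of n] T1 by simp
next
  case (step k)
  define D where "D = fps_X * fps_deriv T"
  \<comment> \<open>The product \<open>T ^ k * D\<close> occurs in the derivatives of both
    \<open>T ^ k\<close> and \<open>T ^ Suc k\<close>; eliminating it relates the coefficients of
    the two powers.\<close>
  have "T ^ (k - 1) * D = T ^ (k - 1) * (T + T * D)" using ode by (simp add: D_def)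
  also have "\<dots> = T ^ k + T ^ k * D"
    using step.prems by (cases k) (simp_all add: ring_distribs mult_ac)
  finally have "fps_X * fps_deriv (T ^ k) = fps_const (real k) * (T ^ k + T ^ k * D)"
    by (simp add: fps_deriv_power D_def mult_ac fps_of_nat)
  moreover have "fps_X * fps_deriv (T ^ Suc k) = fps_const (real (Suc k)) * (T ^ k * D)"
    by (simp add: fps_deriv_power D_def mult_ac fps_of_nat del: power_Suc of_nat_Suc)
  ultimately have "(fps_const (real (Suc k)) * (fps_X * fps_deriv (T ^ k))) $ n
      = (fps_const (real (Suc k) * real k) * T ^ k + fps_const (real k) * (fps_X * fps_deriv (T ^ Suc k))) $ n"
    by (simp only: ring_distribs mult_ac fps_const_mult[symmetric])
  then have *: "(real n - real k) * real (Suc k) * (T ^ k) $ n = real k * (real n * (T ^ Suc k) $ n)"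
    unfolding fps_add_nth fps_mult_left_const_nth fps_X_deriv_nth by (simp add: algebra_simps)
  define m where "m = n - Suc k"
  have n: "n = m + Suc k" using step.hyps by (simp add: m_def)
  have IH: "(T ^ Suc k) $ n = real (Suc k) * real n ^ m / (real n * fact m)"
    using step by (simp add: m_def)
  have "real (Suc m) * real (Suc k) * (T ^ k) $ n = real k * real (Suc k) * real n ^ m / fact m"
    using * unfolding IH by (simp add: n)
  then have "(T ^ k) $ n = real k * real n ^ m / (real (Suc m) * fact m)"
    by (simp add: field_simps del: of_nat_Suc)
  moreover have "n - k = Suc m" using n by simp
  ultimately show ?case using n by simp
qed

lemma egf_rooted_count: "egf rooted_count = T_fps"
proof (rule fps_ext)
  fix n
  have "egf rooted_count $ n = real n ^ (n - 1) / fact n" if "n \<ge> 1"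
    using tree_power_nth[OF egf_rooted_count_ode, of 1 n] that count_1
    by (cases n) (simp_all add: egf_nth)
  then show "egf rooted_count $ n = T_fps $ n"
    by (cases "n = 0") (simp_all add: egf_nth T_fps_def)
qed

lemma T_fps_ode: "fps_X * fps_deriv T_fps = T_fps + T_fps * (fps_X * fps_deriv T_fps)"
  using egf_rooted_count_ode by (simp only: egf_rooted_count)

lemma T_fps_0 [simp]: "T_fps $ 0 = 0" and T_fps_1: "T_fps $ 1 = 1"
  by (simp_all add: T_fps_def)

lemma rooted_count_eq: "n \<ge> 1 \<Longrightarrow> real (rooted_count n) = real n ^ (n - 1)"
  using arg_cong[OF egf_rooted_count, of "\<lambda>f. f $ n"] by (simp add: egf_nth T_fps_def)

text \<open>On the right, coefficient \<open>n\<close> of the unknown occurs only with the factor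
  \<open>n - i = 0\<close> or a vanishing constant term, so the lower coefficients determine it
  unless \<open>n = 1\<close>, where the factor \<open>n - 1\<close> on the left is zero.\<close>

lemma light_ode_unique:
  fixes L M T :: "real fps"
  assumes L: "fps_X * fps_deriv L = L + L * (fps_X * fps_deriv (T - L))"
    and M: "fps_X * fps_deriv M = M + M * (fps_X * fps_deriv (T - M))"
    and 0: "L $ 0 = 0" "M $ 0 = 0" and 1: "L $ 1 = M $ 1"
  shows "L = M"
proof (rule fps_ext)
  fix n show "L $ n = M $ n"
  proof (induction n rule: less_induct)
    case (less n)
    have rec: "(real n - 1) * f $ n = (\<Sum>i=0..n. f $ i * (real (n - i) * (T $ (n - i) - f $ (n - i))))"
      if "fps_X * fps_deriv f = f + f * (fps_X * fps_deriv (T - f))" for f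
    proof -
      have "(fps_X * fps_deriv f) $ n = (f + f * (fps_X * fps_deriv (T - f))) $ n"
        using that by simp
      then show ?thesis
        unfolding fps_add_nth fps_mult_nth[of f] fps_X_deriv_nth by (simp add: algebra_simps)
    qed
    consider "n = 0" | "n = 1" | "n > 1" by linarith
    then show ?case
    proof cases
      case 3
      have "(\<Sum>i=0..n. L $ i * (real (n - i) * (T $ (n - i) - L $ (n - i))))
          = (\<Sum>i=0..n. M $ i * (real (n - i) * (T $ (n - i) - M $ (n - i))))"
      proof (intro sum.cong refl)
        fix i assume "i \<in> {0..n}"
        then consider "i = 0" | "i = n" | "0 < i" "i < n" by fastforce
        then show "L $ i * (real (n - i) * (T $ (n - i) - L $ (n - i)))
            = M $ i * (real (n - i) * (T $ (n - i) - M $ (n - i)))"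
          using less.IH[of i] less.IH[of "n - i"] 0 by cases simp_all
      qed
      then have "(real n - 1) * L $ n = (real n - 1) * M $ n"
        unfolding rec[OF L] rec[OF M] .
      then show ?thesis using 3 by simp
    qed (use 0 1 in simp_all)
  qed
qed

lemma egf_light_count_ode:
  "fps_X * fps_deriv (egf light_count)
     = egf light_count + egf light_count * (fps_X * fps_deriv (T_fps - egf light_count))"
proof -
  \<comment> \<open>\<open>light_count_le\<close> turns the natural subtraction of the recurrence
    into a genuine one.\<close>
  have "T_fps - egf light_count = egf (\<lambda>n. rooted_count n - light_count n)"
    unfolding egf_rooted_count[symmetric]
    by (rule fps_ext) (simp add: egf_nth of_nat_diff light_count_le diff_divide_distrib)
  then show ?thesis
    by (simp only: egf_pointed[OF _ _ _ light_count_recurrence] count_0 diff_self_eq_0)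
qed

text \<open>Substituting \<open>- T_fps\<close> into the equation of \<open>T_fps\<close> and
  applying the chain rule yields a relation free of the composed derivative, kept in multiplied form
  to avoid inverses.\<close>

lemma T_comp_uminus_ode:
  defines "M \<equiv> - (T_fps oo - T_fps)"
  shows "T_fps * (fps_deriv M * (1 + M)) = M * fps_deriv T_fps"
proof -
  let ?y = "- T_fps" let ?W = "T_fps oo - T_fps"
  have y0: "?y $ 0 = 0" by simp
  have "(fps_X * fps_deriv T_fps) oo ?y = (T_fps + T_fps * (fps_X * fps_deriv T_fps)) oo ?y"
    using T_fps_ode by simp
  then have *: "?y * (fps_deriv T_fps oo ?y) = ?W + ?W * (?y * (fps_deriv T_fps oo ?y))"
    by (simp only: fps_compose_mult_distrib[OF y0] fps_compose_add_distrib fps_X_fps_compose_startby0[OF y0])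
  have d: "fps_deriv ?W = (fps_deriv T_fps oo ?y) * fps_deriv ?y"
    by (rule fps_compose_deriv[OF y0])
  have "?y * (fps_deriv T_fps oo ?y) * (1 - ?W)
      = ?y * (fps_deriv T_fps oo ?y) - ?W * (?y * (fps_deriv T_fps oo ?y))"
    by (simp add: algebra_simps)
  also have "\<dots> = ?W"
    using * by (rule diff_eq_eq[THEN iffD2])
  finally have W: "?y * (fps_deriv T_fps oo ?y) * (1 - ?W) = ?W" .
  have "?y * fps_deriv ?W * (1 - ?W) = ?y * (fps_deriv T_fps oo ?y) * (1 - ?W) * fps_deriv ?y"
    unfolding d by (simp only: mult_ac)
  also have "\<dots> = ?W * fps_deriv ?y" by (simp only: W)
  finally have "?y * fps_deriv ?W * (1 - ?W) = ?W * fps_deriv ?y" .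
  then show ?thesis unfolding M_def by (simp add: algebra_simps)
qed

text \<open>In \<open>T_comp_uminus_ode\<close>, replacing \<open>x T'\<close> by
  \<open>T (1 + x T')\<close> and cancelling \<open>T\<close> gives the equation of the light
  series, whose solution is unique.\<close>

lemma egf_light_count: "egf light_count = - (T_fps oo - T_fps)"
proof (rule light_ode_unique[OF egf_light_count_ode])
  let ?M = "- (T_fps oo - T_fps)"
  let ?T = T_fps
  have T: "fps_X * fps_deriv ?T = ?T * (1 + fps_X * fps_deriv ?T)"
    using T_fps_ode by (simp add: algebra_simps)
  have nz: "?T \<noteq> 0" using T_fps_1 by auto
  have "?T * (fps_X * fps_deriv ?M * (1 + ?M)) = fps_X * (?T * (fps_deriv ?M * (1 + ?M)))"
    by (simp only: mult_ac)
  also have "\<dots> = ?M * (fps_X * fps_deriv ?T)"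
    unfolding T_comp_uminus_ode by (simp only: mult_ac)
  also have "\<dots> = ?T * (?M * (1 + fps_X * fps_deriv ?T))"
    by (subst T) (simp only: mult_ac)
  finally have "fps_X * fps_deriv ?M * (1 + ?M) = ?M * (1 + fps_X * fps_deriv ?T)"
    using nz by (simp only: mult_cancel_left) simp
  then show "fps_X * fps_deriv ?M = ?M + ?M * (fps_X * fps_deriv (?T - ?M))"
    by (simp add: algebra_simps)
  show "?M $ 0 = 0" by simp
  show "egf light_count $ 1 = ?M $ 1"
    by (simp add: egf_nth fps_compose_nth T_fps_def count_1[simplified])
qed (simp add: egf_nth)

lemma N_G_egf: "egf N_G = - (T_fps oo - T_fps)"
proof -
  have "N_G = light_count" by (rule ext) (rule N_G_eq)
  then show ?thesis using egf_light_count by simp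
qed

lemma N_R_egf: "egf N_R = (T_fps oo - T_fps)\<^sup>2"
proof -
  have "egf N_R = egf light_count * egf light_count"
  proof (rule fps_ext)
    fix n
    have "N_R 0 = 0" by (simp add: N_R_eq)
    then show "egf N_R $ n = (egf light_count * egf light_count) $ n"
      by (simp add: egf_mult_nth egf_nth N_R_eq)
  qed
  then show ?thesis unfolding egf_light_count by (simp add: power2_eq_square)
qed

lemma N_B_egf: "egf N_B = T_fps + (T_fps oo - T_fps) - (T_fps oo - T_fps)\<^sup>2"
proof -
  have "egf N_B + egf N_R + egf N_G = egf rooted_count"
    by (rule fps_ext) (auto simp: egf_def N_sum[symmetric] add_divide_distrib)
  then show ?thesis by (simp add: N_R_egf N_G_egf egf_rooted_count algebra_simps)
qed

section \<open>Explicit formulas for the coefficients\<close>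

lemma T_fps_power_nth:
  assumes "1 \<le> k" "k \<le> n"
  shows "(T_fps ^ k) $ n = real k / real n * (real n ^ n / real n ^ k) / fact (n - k)"
  using tree_power_nth[OF T_fps_ode T_fps_0 T_fps_1 assms] assms
  by (simp add: power_diff)

text \<open>Lagrange's formula applied to each power of \<open>T_fps\<close>; powers above
  \<open>n\<close> do not reach coefficient \<open>n\<close>. The outer series will be
  \<open>T_fps\<close> for green and its square for red vertices.\<close>

lemma compose_uminus_T_nth:
  assumes "n \<ge> 1" "f $ 0 = 0"
  shows "(f oo - T_fps) $ n * fact n / real n ^ (n - 1)
     = (\<Sum>l=1..n. f $ l * real l * fact l * (- 1 / real n) ^ l * real (n choose l))"
proof -
  have "(f oo - T_fps) $ n = (\<Sum>l=1..n. f $ l * ((- T_fps) ^ l) $ n)"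
    unfolding fps_compose_nth using assms by (simp add: sum.atLeast_Suc_atMost)
  then have "(f oo - T_fps) $ n * fact n / real n ^ (n - 1)
      = (\<Sum>l=1..n. f $ l * ((- T_fps) ^ l) $ n * fact n / real n ^ (n - 1))"
    by (simp only: sum_distrib_right sum_divide_distrib)
  moreover have summand: "f $ l * ((- T_fps) ^ l) $ n * fact n / real n ^ (n - 1)
      = f $ l * real l * fact l * (- 1 / real n) ^ l * real (n choose l)" if "l \<in> {1..n}" for l
  proof -
    have "((- T_fps) ^ l) $ n = (- 1) ^ l * (T_fps ^ l) $ n"
    proof -
      have "(- T_fps) ^ l = fps_const ((- 1) ^ l) * T_fps ^ l"
        by (subst power_minus) (simp add: fps_const_power[symmetric] fps_const_neg[symmetric] del: fps_const_power fps_const_neg)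
      then show ?thesis by simp
    qed
    moreover have "real n ^ n = real n * real n ^ (n - 1)" using assms by (cases n) simp_all
    moreover have "(- 1 / real n) ^ l = (- 1) ^ l / real n ^ l" by (rule power_divide)
    ultimately show ?thesis
      using that assms by (simp only: T_fps_power_nth) (simp add: T_fps_power_nth binomial_fact)
  qed
  ultimately show ?thesis using sum.cong[OF refl summand, of "{1..n}"] by (simp only:)
qed

lemma N_G_formula:
  assumes "n \<ge> 1"
  shows "real (N_G n) / real n ^ (n - 1) = - (\<Sum>l=1..n. (- real l / real n) ^ l * real (n choose l))"
proof -
  have "real (N_G n) = - ((T_fps oo - T_fps) $ n) * fact n"
    using arg_cong[OF N_G_egf, of "\<lambda>f. f $ n"] assms by (simp add: egf_def divide_eq_eq)
  then have "real (N_G n) / real n ^ (n - 1) = - ((T_fps oo - T_fps) $ n * fact n / real n ^ (n - 1))"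
    by simp
  also have "\<dots> = - (\<Sum>l=1..n. (- real l / real n) ^ l * real (n choose l))"
    unfolding compose_uminus_T_nth[OF assms T_fps_0]
  proof (intro arg_cong[where f = uminus] sum.cong refl)
    fix l assume l: "l \<in> {1..n}"
    have "real l ^ l = real l * real l ^ (l - 1)" using l by (cases l) simp_all
    moreover have "(- real l / real n) ^ l = (- 1 / real n) ^ l * real l ^ l"
      by (simp add: power_mult_distrib[symmetric])
    ultimately show "T_fps $ l * real l * fact l * (- 1 / real n) ^ l * real (n choose l)
        = (- real l / real n) ^ l * real (n choose l)"
      using l by (simp add: T_fps_def)
  qed
  finally show ?thesis .
qed

lemma N_R_formula:
  assumes "n \<ge> 1"
  shows "real (N_R n) / real n ^ (n - 1) =
    - 2 * (\<Sum>l=1..n. (- real l / real n) ^ l * (1 / real l - 1) * real (n choose l))"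
proof -
  have z: "T_fps\<^sup>2 $ 0 = 0" by (simp add: power2_eq_square)
  have "(T_fps oo - T_fps)\<^sup>2 = T_fps\<^sup>2 oo - T_fps"
    by (rule fps_compose_power) simp
  then have "real (N_R n) = ((T_fps\<^sup>2 oo - T_fps) $ n) * fact n"
    using arg_cong[OF N_R_egf, of "\<lambda>f. f $ n"] assms by (simp add: egf_def divide_eq_eq)
  then have "real (N_R n) / real n ^ (n - 1) = (T_fps\<^sup>2 oo - T_fps) $ n * fact n / real n ^ (n - 1)"
    by simp
  also have "\<dots> = (\<Sum>l=1..n. - 2 * ((- real l / real n) ^ l * (1 / real l - 1) * real (n choose l)))"
    unfolding compose_uminus_T_nth[OF assms z]
  proof (intro sum.cong refl)
    fix l assume l: "l \<in> {1..n}"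
    \<comment> \<open>\<open>T_fps_power_nth\<close> with exponent 2 requires \<open>2 <= l\<close>;
      for \<open>l = 1\<close> both sides are zero.\<close>
    have T2': "T_fps\<^sup>2 $ l * real l * fact l = 2 * real l ^ l * (1 - 1 / real l)"
    proof (cases "l = 1")
      case True
      then show ?thesis by (simp add: power2_eq_square fps_mult_nth)
    next
      case False
      then obtain m where m: "l = Suc (Suc m)" using l by (cases l; cases "l - 1") auto
      have T2: "T_fps\<^sup>2 $ l = 2 / real l * (real l ^ l / real l ^ 2) / fact m"
        using T_fps_power_nth[of 2 l] by (simp add: m)
      have fact_l: "fact l = real l * (real l - 1) * fact m" by (simp add: m)
      show ?thesis unfolding T2 fact_l using l by (simp add: field_simps power2_eq_square)
    qed
    have e: "(- real l / real n) ^ l = (- 1 / real n) ^ l * real l ^ l"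
      by (simp add: power_mult_distrib[symmetric])
    show "T_fps\<^sup>2 $ l * real l * fact l * (- 1 / real n) ^ l * real (n choose l)
        = - 2 * ((- real l / real n) ^ l * (1 / real l - 1) * real (n choose l))"
      unfolding T2' e by (simp add: algebra_simps)
  qed
  finally show ?thesis by (simp only: sum_distrib_left)
qed

lemma N_B_ratio:
  assumes "n \<ge> 1"
  shows "real (N_B n) / real n ^ (n - 1)
    = 1 - real (N_R n) / real n ^ (n - 1) - real (N_G n) / real n ^ (n - 1)"
proof -
  have "real (N_B n + N_R n + N_G n) = real n ^ (n - 1)"
    by (simp only: N_sum rooted_count_eq[OF assms])
  then have "real (N_B n) = real n ^ (n - 1) - real (N_R n) - real (N_G n)" by simp
  then show ?thesis using assms by (simp add: diff_divide_distrib)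
qed

lemma N_B_formula:
  assumes "n \<ge> 1"
  shows "real (N_B n) / real n ^ (n - 1) =
    1 + (\<Sum>l=1..n. (- real l / real n) ^ l * (2 / real l - 1) * real (n choose l))"
proof -
  have "(\<Sum>l=1..n. (- real l / real n) ^ l * (2 / real l - 1) * real (n choose l))
      = (\<Sum>l=1..n. 2 * ((- real l / real n) ^ l * (1 / real l - 1) * real (n choose l))
          + (- real l / real n) ^ l * real (n choose l))"
    by (intro sum.cong refl) (simp add: algebra_simps)
  then show ?thesis
    unfolding N_B_ratio[OF assms] N_G_formula[OF assms] N_R_formula[OF assms]
    by (simp only: sum.distrib sum_distrib_left[symmetric])
qed

section \<open>The first ten values\<close>

lemma N_R_values: "map N_R [1..<11] = [0, 2, 0, 48, 120, 4560, 35700, 1048992, 15514128, 456726240]"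
proof -
  \<comment> \<open>Multiplication by \<open>n ^ (n - 1)\<close> makes the explicit sum a number
    that can be evaluated by simplification.\<close>
  have v: "N_R n = m" if "n \<ge> 1"
    "- 2 * (\<Sum>l=1..n. (- real l / real n) ^ l * (1 / real l - 1) * real (n choose l)) * real n ^ (n - 1) = real m" for n m
    using N_R_formula[OF that(1)] that by (simp add: field_simps)
  have "N_R 1 = 0" "N_R 2 = 2" "N_R 3 = 0" "N_R 4 = 48" "N_R 5 = 120" "N_R 6 = 4560"
      "N_R 7 = 35700" "N_R 8 = 1048992" "N_R 9 = 15514128" "N_R 10 = 456726240"
    by (rule v, simp, simp add: sum.atLeast_Suc_atMost binomial_fact fact_numeral power_divide)+
  moreover have "[1..<11] = [1, 2, 3, 4, 5, 6, 7, 8, 9, 10]" by code_simp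
  ultimately show ?thesis by simp
qed

lemma N_G_values: "map N_G [1..<11] = [1, 0, 6, 12, 320, 2190, 51492, 685496, 17286768, 348213690]"
proof -
  have v: "N_G n = m" if "n \<ge> 1"
    "- (\<Sum>l=1..n. (- real l / real n) ^ l * real (n choose l)) * real n ^ (n - 1) = real m" for n m
    using N_G_formula[OF that(1)] that by (simp add: field_simps)
  have "N_G 1 = 1" "N_G 2 = 0" "N_G 3 = 6" "N_G 4 = 12" "N_G 5 = 320" "N_G 6 = 2190"
      "N_G 7 = 51492" "N_G 8 = 685496" "N_G 9 = 17286768" "N_G 10 = 348213690"
    by (rule v, simp, simp add: sum.atLeast_Suc_atMost binomial_fact fact_numeral power_divide)+
  moreover have "[1..<11] = [1, 2, 3, 4, 5, 6, 7, 8, 9, 10]" by code_simp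
  ultimately show ?thesis by simp
qed

lemma N_B_values: "map N_B [1..<11] = [0, 0, 3, 4, 185, 1026, 30457, 362664, 10245825, 195060070]"
proof -
  have "[1..<11] = [1, 2, 3, 4, 5, 6, 7, 8, 9, 10]" by code_simp
  moreover have "N_B n = n ^ (n - 1) - N_R n - N_G n" if "n \<ge> 1" for n
    using rooted_count_eq[OF that] N_sum[of n] by (simp flip: of_nat_power)
  ultimately show ?thesis using N_R_values N_G_values by simp
qed

section \<open>Values at the dominant singularity\<close>

text \<open>These are the terms of the series at \<open>x = exp (- 1)\<close>, so that
  \<open>scaled f sums s\<close> states that \<open>f\<close> takes the value \<open>s\<close>
  there.\<close>

definition scaled :: "real fps \<Rightarrow> nat \<Rightarrow> real" where
  "scaled f n = f $ n / exp (real n)"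

lemma scaled_mult: "scaled (f * g) n = (\<Sum>i\<le>n. scaled f i * scaled g (n - i))"
proof -
  have "exp (real n) = exp (real i) * exp (real (n - i))" if "i \<le> n" for i
    using that by (simp add: exp_add[symmetric] of_nat_diff)
  then show ?thesis
    unfolding scaled_def fps_mult_nth sum_divide_distrib atLeast0AtMost
    by (intro sum.cong refl) auto
qed

lemma scaled_diff: "scaled (f - g) n = scaled f n - scaled g n"
  by (simp add: scaled_def diff_divide_distrib)

section \<open>From differential to functional equations\<close>

lemma fps_linear_ode_unique:
  fixes F W G :: "real fps"
  assumes F: "fps_X * fps_deriv F = F + F * (fps_X * fps_deriv G)"
    and W: "fps_X * fps_deriv W = W + W * (fps_X * fps_deriv G)"
    and 1: "F $ 1 = W $ 1"
  shows "F = W"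
proof (rule fps_ext)
  fix n show "F $ n = W $ n"
  proof (induction n rule: less_induct)
    case (less n)
    have rec: "(real n - 1) * f $ n = (\<Sum>i=0..n. f $ i * (real (n - i) * G $ (n - i)))"
      if "fps_X * fps_deriv f = f + f * (fps_X * fps_deriv G)" for f
    proof -
      have "(fps_X * fps_deriv f) $ n = (f + f * (fps_X * fps_deriv G)) $ n" using that by simp
      then show ?thesis
        unfolding fps_add_nth fps_mult_nth[of f] fps_X_deriv_nth by (simp add: algebra_simps)
    qed
    show ?case
    proof (cases "n = 1")
      case False
      have "(\<Sum>i=0..n. F $ i * (real (n - i) * G $ (n - i)))
          = (\<Sum>i=0..n. W $ i * (real (n - i) * G $ (n - i)))"
        by (intro sum.cong refl) (use less.IH in \<open>force simp: le_less\<close>)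
      then have "(real n - 1) * F $ n = (real n - 1) * W $ n"
        unfolding rec[OF F] rec[OF W] .
      then show ?thesis using False by simp
    qed (use 1 in simp)
  qed
qed

text \<open>This integrates the two differential equations to \<open>T = x exp T\<close> and
  \<open>L = x exp (T - L)\<close>, which can be evaluated at a point.\<close>

lemma fps_X_exp_unique:
  fixes F G :: "real fps"
  assumes F: "fps_X * fps_deriv F = F + F * (fps_X * fps_deriv G)"
    and F1: "F $ 1 = 1" and G0: "G $ 0 = 0"
  shows "F = fps_X * (fps_exp 1 oo G)"
proof (rule fps_linear_ode_unique[OF F])
  let ?E = "fps_exp 1 oo G"
  have "fps_deriv ?E = ?E * fps_deriv G"
    by (simp add: fps_compose_deriv[OF G0])
  then show "fps_X * fps_deriv (fps_X * ?E)
      = fps_X * ?E + fps_X * ?E * (fps_X * fps_deriv G)"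
    by (simp add: algebra_simps)
  show "F $ 1 = (fps_X * ?E) $ 1" using F1 by simp
qed

text \<open>Cauchy products require absolute convergence. Nonnegative coefficients provide it, so
  their sign is carried through the induction.\<close>

lemma scaled_power_sums:
  assumes nonneg: "\<And>n. G $ n \<ge> 0" and s: "scaled G sums s"
  shows "scaled (G ^ i) sums (s ^ i) \<and> (\<forall>n. (G ^ i) $ n \<ge> 0)"
proof (induction i)
  case 0
  have "scaled 1 sums (\<Sum>n\<in>{0}. scaled 1 n)" by (rule sums_finite) (auto simp: scaled_def)
  moreover have "scaled 1 0 = 1" by (simp add: scaled_def)
  ultimately show ?case by simp
next
  case (Suc i)
  have abs: "\<bar>scaled G n\<bar> = scaled G n" "\<bar>scaled (G ^ i) n\<bar> = scaled (G ^ i) n" for n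
    using nonneg Suc by (simp_all add: scaled_def)
  have "(\<lambda>n. \<Sum>k\<le>n. scaled G k * scaled (G ^ i) (n - k)) sums (s * s ^ i)"
    using Cauchy_product_sums[of "scaled G" "scaled (G ^ i)"] s Suc by (simp add: abs sums_iff)
  moreover have "(G ^ Suc i) $ n \<ge> 0" for n
    using nonneg Suc by (auto simp: fps_mult_nth intro!: sum_nonneg)
  moreover have "scaled (G ^ Suc i) = (\<lambda>n. \<Sum>k\<le>n. scaled G k * scaled (G ^ i) (n - k))"
    by (simp add: fun_eq_iff scaled_mult)
  ultimately show ?case by simp
qed

text \<open>The value is a double sum over exponents \<open>i\<close> and coefficients
  \<open>n\<close>. Its terms are nonnegative, so it may be summed in either order: rows give the
  exponential series of \<open>s\<close>, and columns are finite because \<open>G ^ i\<close> starts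
  at \<open>x ^ i\<close>.\<close>

lemma scaled_exp_sums:
  assumes G0: "G $ 0 = 0" and nonneg: "\<And>n. G $ n \<ge> 0" and s: "scaled G sums s"
  shows "scaled (fps_exp 1 oo G) sums exp s"
proof -
  define g where "g = (\<lambda>(i, n). scaled (G ^ i) n / fact i)"
  note pow = scaled_power_sums[OF nonneg s]
  have nn: "g (i, n) \<ge> 0" for i n using pow[of i] by (simp add: g_def scaled_def)
  have row: "((\<lambda>n. g (i, n)) has_sum (s ^ i / fact i)) UNIV" for i
    using pow[of i] nn[of i] by (intro sums_nonneg_imp_has_sum) (auto simp: g_def intro: sums_divide)
  have s0: "s \<ge> 0"
    using s nonneg by (intro sums_le[OF _ sums_zero s]) (simp add: scaled_def)
  have "(\<lambda>i. s ^ i / fact i) sums exp s"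
    using exp_converges[of s] by (simp add: divide_inverse mult.commute)
  then have tot: "((\<lambda>i. s ^ i / fact i) has_sum exp s) UNIV"
    using s0 by (intro sums_nonneg_imp_has_sum) auto
  have "g summable_on UNIV \<times> UNIV"
    by (rule summable_on_SigmaI[OF row]) (use tot nn in \<open>auto dest: has_sum_imp_summable\<close>)
  then have "(g has_sum exp s) (UNIV \<times> UNIV)"
    using row tot by (intro has_sum_SigmaI) auto
  then have sw: "((\<lambda>(n, i). g (i, n)) has_sum exp s) (UNIV \<times> UNIV)"
    by (rule has_sum_swap[THEN iffD1])
  have col: "((\<lambda>i. g (i, n)) has_sum scaled (fps_exp 1 oo G) n) UNIV" for n
  proof -
    have "((\<lambda>i. g (i, n)) has_sum (\<Sum>i\<in>{0..n}. g (i, n))) UNIV"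
      by (subst has_sum_cong_neutral[of "{0..n}" UNIV _ "\<lambda>i. g (i, n)"])
        (use startsby_zero_power_prefix[OF G0] in \<open>auto simp: g_def scaled_def\<close>)
    moreover have "(\<Sum>i\<in>{0..n}. g (i, n)) = scaled (fps_exp 1 oo G) n"
      by (simp add: g_def scaled_def fps_compose_nth sum_divide_distrib field_simps)
    ultimately show ?thesis by simp
  qed
  have "(scaled (fps_exp 1 oo G) has_sum exp s) UNIV"
    using has_sum_SigmaD[OF sw] col by simp
  then show ?thesis by (rule has_sum_imp_sums)
qed

text \<open>The factor \<open>fps_X\<close> shifts coefficients by one, which at
  \<open>exp (- 1)\<close> multiplies the value by \<open>exp (- 1)\<close>.\<close>

lemma scaled_X_exp_value:
  assumes F: "F = fps_X * (fps_exp 1 oo G)" and G0: "G $ 0 = 0" and nonneg: "\<And>n. G $ n \<ge> 0"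
    and a: "scaled F sums a" and b: "scaled G sums b"
  shows "a = exp (b - 1)"
proof -
  have "scaled F (Suc n) = scaled (fps_exp 1 oo G) n * exp (- 1)" for n
    by (simp add: F scaled_def exp_add exp_minus field_simps)
  then have "(\<lambda>n. scaled F (Suc n)) sums (exp b * exp (- 1))"
    using sums_mult2[OF scaled_exp_sums[OF G0 nonneg b], of "exp (- 1)"] by simp
  moreover have "scaled F 0 = 0" by (simp add: F scaled_def)
  ultimately have "scaled F sums (exp b * exp (- 1))" using sums_Suc[of "scaled F"] by simp
  then show ?thesis using a sums_unique2 by (fastforce simp: exp_diff exp_minus divide_inverse)
qed

text \<open>\<open>self_power n\<close> is \<open>n\<close> times the coefficient of \<open>T\<close> at the dominant singularity
  \<open>exp (- 1)\<close>; note \<open>self_power 0 = 1\<close>.\<close>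

definition self_power :: "nat \<Rightarrow> real" where
  "self_power n = real n ^ n / (fact n * exp (real n))"

lemma self_power_pos: "self_power n > 0"
  by (cases n) (simp_all add: self_power_def)

lemma self_power_Suc:
  assumes "n \<ge> 1"
  shows "self_power (Suc n) = self_power n * ((1 + 1 / real n) ^ n / exp 1)"
proof -
  have "real (Suc n) ^ n = real n ^ n * (1 + 1 / real n) ^ n"
    using assms by (simp add: power_mult_distrib[symmetric] field_simps)
  moreover have "exp (real (Suc n)) = exp 1 * exp (real n)" by (simp add: exp_add)
  ultimately show ?thesis
    by (simp add: self_power_def field_simps del: of_nat_Suc)
qed

lemma self_power_ratio: "(\<lambda>n. self_power (Suc n) / self_power n) \<longlonglongrightarrow> 1"
proof -
  have "(\<lambda>n. (1 + 1 / real n) ^ n / exp 1) \<longlonglongrightarrow> exp 1 / exp 1"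
    by (intro tendsto_intros tendsto_exp_limit_sequentially) simp
  then have "(\<lambda>n. (1 + 1 / real n) ^ n / exp 1) \<longlonglongrightarrow> 1" by simp
  moreover have "eventually (\<lambda>n. (1 + 1 / real n) ^ n / exp 1 = self_power (Suc n) / self_power n) sequentially"
    using eventually_ge_at_top[of 1]
  proof eventually_elim
    case (elim n)
    then show ?case using self_power_pos[of n] by (simp add: self_power_Suc)
  qed
  ultimately show ?thesis by (rule Lim_transform_eventually)
qed

text \<open>A crude Stirling estimate by monotonicity: from \<open>n = 1\<close> on,
  \<open>self_power n * sqrt n\<close> does not decrease and
  \<open>self_power n * sqrt (n + 1)\<close> does not increase, and both are compared with their
  first values.\<close>

lemma self_power_bounds:
  "exp (- 1) \<le> self_power n * sqrt (real n + 1)" "self_power n * sqrt (real n + 1) \<le> 1"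
proof -
  have lower: "1 \<le> (1 + 1 / real n) ^ n / exp 1 * sqrt ((real n + 1) / real n)"
    and upper: "(1 + 1 / real n) ^ n / exp 1 * sqrt ((real n + 2) / (real n + 1)) \<le> 1" if n: "n \<ge> 1" for n
  proof -
    have q: "ln (1 + 1 / real n) = ln (real n + 1) - ln (real n)"
    proof -
      have "1 + 1 / real n = (real n + 1) / real n" using n by (simp add: field_simps)
      then show ?thesis using n by (simp add: ln_div)
    qed
    have l: "ln ((1 + 1 / real n) ^ n) = real n * ln (1 + 1 / real n)"
      by (rule ln_realpow)
    have nz: "1 + 1 / real n \<noteq> 0" by (rule less_imp_neq[symmetric], rule add_pos_nonneg) simp_all
    have p: "(1 + 1 / real n) ^ n > 0" by (intro zero_less_power add_pos_nonneg) simp_all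
    \<comment> \<open>The midpoint rule for the integral of \<open>1 / x\<close> from
      \<open>n\<close> to \<open>n + 1\<close> bounds the logarithm from below; the trapezoidal rule
      bounds it from above further down.\<close>
    have "2 * 1 / (2 * real n + 1) \<le> ln (real n + 1) - ln (real n)"
      using ln_inverse_approx_ge[of "real n" "real n + 1"] n by (simp add: algebra_simps)
    then have "1 \<le> (real n + 1 / 2) * ln (1 + 1 / real n)"
      unfolding q using n by (simp add: field_simps)
    then have "0 \<le> ln ((1 + 1 / real n) ^ n / exp 1 * sqrt ((real n + 1) / real n))"
      using n p nz by (simp add: ln_mult ln_div ln_sqrt l q algebra_simps diff_divide_distrib)
    then show "1 \<le> (1 + 1 / real n) ^ n / exp 1 * sqrt ((real n + 1) / real n)"
      using n p by (subst (asm) ln_ge_zero_iff) auto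
    have "ln (1 + 1 / real n) \<le> (1 / real n + 1 / (real n + 1)) / 2"
      unfolding q using ln_inverse_approx_le[of "real n" 1] n by (simp add: inverse_eq_divide)
    then have "real n * ln (1 + 1 / real n) \<le> real n * ((1 / real n + 1 / (real n + 1)) / 2)"
      by (intro mult_left_mono) auto
    also have "\<dots> = (1 + real n / (real n + 1)) / 2" using n by (simp add: distrib_left)
    also have "real n / (real n + 1) = 1 - 1 / (real n + 1)" by (simp add: field_simps)
    also have "(1 + (1 - 1 / (real n + 1))) / 2 = 1 - 1 / (real n + 1) / 2"
      by (simp add: field_simps)
    finally have 1: "real n * ln (1 + 1 / real n) \<le> 1 - 1 / (real n + 1) / 2" .
    have "ln ((real n + 2) / (real n + 1)) = ln (1 + 1 / (real n + 1))"
      by (simp add: field_simps)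
    also have "\<dots> \<le> 1 / (real n + 1)" by (rule ln_add_one_self_le_self) simp
    finally have 2: "ln ((real n + 2) / (real n + 1)) \<le> 1 / (real n + 1)" .
    have "ln ((1 + 1 / real n) ^ n / exp 1 * sqrt ((real n + 2) / (real n + 1)))
        = real n * ln (1 + 1 / real n) - 1 + ln ((real n + 2) / (real n + 1)) / 2"
      using p nz by (simp add: ln_mult ln_div ln_sqrt l)
    also have "\<dots> \<le> 0"
    proof -
      have "x - 1 + y / 2 \<le> 0" if "x \<le> 1 - d / 2" "y \<le> d" for x y d :: real
        using that by linarith
      from this[OF 1 2] show ?thesis .
    qed
    finally show "(1 + 1 / real n) ^ n / exp 1 * sqrt ((real n + 2) / (real n + 1)) \<le> 1"
      using n p by (subst (asm) ln_le_zero_iff) auto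
  qed
  have low: "exp (- 1) \<le> self_power n * sqrt (real n)" if "n \<ge> 1" for n
    using that
  proof (induction n rule: dec_induct)
    case base
    then show ?case by (simp add: self_power_def exp_minus field_simps)
  next
    case (step n)
    have "self_power n * sqrt (real n) * 1
        \<le> self_power n * sqrt (real n) * ((1 + 1 / real n) ^ n / exp 1 * sqrt ((real n + 1) / real n))"
      using step.hyps by (intro mult_left_mono lower) (auto simp: self_power_pos less_imp_le)
    also have "\<dots> = self_power (Suc n) * sqrt (real (Suc n))"
      using step.hyps by (simp add: self_power_Suc real_sqrt_divide add.commute)
    finally show ?case using step.IH by simp
  qed
  have up: "self_power n * sqrt (real n + 1) \<le> 1" if "n \<ge> 1" for n
    using that
  proof (induction n rule: dec_induct)
    case base
    have "sqrt 2 \<le> 2" by (rule real_le_lsqrt) auto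
    moreover have "(2::real) \<le> exp 1" using exp_ge_add_one_self[of 1] by simp
    ultimately show ?case by (simp add: self_power_def field_simps)
  next
    case (step n)
    have "self_power (Suc n) * sqrt (real (Suc n) + 1)
      = self_power n * sqrt (real n + 1) * ((1 + 1 / real n) ^ n / exp 1 * sqrt ((real n + 2) / (real n + 1)))"
      using step.hyps by (simp add: self_power_Suc real_sqrt_divide add.commute)
    also have "\<dots> \<le> self_power n * sqrt (real n + 1) * 1"
      using step.hyps by (intro mult_left_mono upper) (auto simp: self_power_pos less_imp_le)
    finally show ?case using step.IH by simp
  qed
  show "self_power n * sqrt (real n + 1) \<le> 1"
    using up[of n] by (cases "n = 0") (auto simp: self_power_def)
  show "exp (- 1) \<le> self_power n * sqrt (real n + 1)"
  proof (cases "n = 0")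
    case False
    have "self_power n * sqrt (real n) \<le> self_power n * sqrt (real n + 1)"
      by (intro mult_left_mono) (auto simp: self_power_pos less_imp_le)
    then show ?thesis using low[of n] False by simp
  qed (simp add: self_power_def)
qed

section \<open>Convolutions of decaying sequences\<close>

definition decay :: "nat \<Rightarrow> real" where
  "decay n = (real n + 1) powr (- 3 / 2)"

lemma decay_pos: "decay n > 0"
  by (simp add: decay_def)

lemma decay_eq: "decay n = 1 / ((real n + 1) * sqrt (real n + 1))"
proof -
  have "(real n + 1) powr (3 / 2) = (real n + 1) powr (1 + 1 / 2)" by simp
  also have "\<dots> = (real n + 1) * sqrt (real n + 1)"
    by (subst powr_add) (simp add: powr_half_sqrt)
  finally show ?thesis
    using powr_minus_divide[of "real n + 1" "3 / 2"] by (simp add: decay_def)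
qed

lemma summable_decay: "summable decay"
proof -
  have "summable (\<lambda>n. real (Suc n) powr (- 3 / 2))"
    by (subst summable_Suc_iff) (simp add: summable_real_powr_iff)
  then show ?thesis by (simp add: decay_def[abs_def] add.commute)
qed

lemma decay_scale:
  assumes "0 < c" "c * (real n + 1) \<le> real i + 1"
  shows "decay i \<le> c powr (- 3 / 2) * decay n"
proof -
  have "decay i \<le> (c * (real n + 1)) powr (- 3 / 2)"
    unfolding decay_def using assms by (intro powr_mono2') auto
  also have "\<dots> = c powr (- 3 / 2) * decay n"
    using assms by (simp add: decay_def powr_mult)
  finally show ?thesis .
qed

lemma sum_convolution_le:
  fixes a u :: "nat \<Rightarrow> real"
  assumes "\<And>n. 0 \<le> a n" "\<And>n. 0 \<le> u n"
  shows "(\<Sum>n\<le>N. \<Sum>i\<le>n. a i * u (n - i)) \<le> (\<Sum>i\<le>N. a i) * (\<Sum>j\<le>N. u j)"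
proof -
  have "(\<Sum>n\<le>N. \<Sum>i\<le>n. a i * u (n - i)) = (\<Sum>(i, j)\<in>{(i, j). i + j \<le> N}. a i * u j)"
    by (rule sum.triangle_reindex_eq[symmetric])
  also have "\<dots> \<le> (\<Sum>(i, j)\<in>{..N} \<times> {..N}. a i * u j)"
    using assms by (intro sum_mono2) auto
  also have "\<dots> = (\<Sum>i\<le>N. a i) * (\<Sum>j\<le>N. u j)"
    by (simp add: sum_product sum.cartesian_product)
  finally show ?thesis .
qed

text \<open>Splitting the convolution at \<open>i = n / 4\<close>: for small \<open>i\<close> the bound on \<open>u\<close> deteriorates by
  the factor \<open>q\<close> only, which the mass \<open>s\<close> compensates; for large \<open>i\<close> the decay of \<open>a\<close> is used.\<close>

lemma renewal_decay:
  fixes a u :: "nat \<Rightarrow> real"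
  assumes a0: "a 0 = 0" and a_nonneg: "\<And>n. 0 \<le> a n" and a_decay: "\<And>n. a n \<le> C * decay n"
    and a_sums: "a sums s" and s: "(3 / 4) powr (- 3 / 2) * s < 1"
    and u_nonneg: "\<And>n. 0 \<le> u n" and u: "\<And>n. u n \<le> a n + (\<Sum>i\<le>n. a i * u (n - i))"
  obtains K where "\<And>n. u n \<le> K * decay n"
proof -
  define q where "q = (3 / 4 :: real) powr (- 3 / 2)"
  have q1: "1 \<le> q"
    using powr_mono2'[of "- 3 / 2" "3 / 4" "1 :: real"] by (simp add: q_def)
  have s0: "0 \<le> s" using sums_le[OF a_nonneg sums_zero a_sums] .
  have s1: "s < 1" using mult_right_mono[OF q1 s0] s by (simp add: q_def)
  have C0: "0 \<le> C" using a_decay[of 0] a0 by (simp add: decay_def)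
  have partial: "(\<Sum>i\<le>N. a i) \<le> s" for N
    using sum_le_suminf[of a "{..N}"] a_sums a_nonneg by (auto simp: sums_iff)
  define S where "S = s / (1 - s)"
  have S0: "0 \<le> S" using s0 s1 by (simp add: S_def)
  \<comment> \<open>Summing the hypothesis bounds a partial sum by \<open>s\<close> plus
    \<open>s\<close> times itself; \<open>s < 1\<close> makes this a bound.\<close>
  have U: "(\<Sum>n\<le>N. u n) \<le> S" for N
  proof -
    have "(\<Sum>n\<le>N. u n) \<le> (\<Sum>n\<le>N. a n + (\<Sum>i\<le>n. a i * u (n - i)))"
      by (intro sum_mono u)
    also have "\<dots> \<le> (\<Sum>n\<le>N. a n) + (\<Sum>n\<le>N. a n) * (\<Sum>n\<le>N. u n)"
      using sum_convolution_le[of a u] a_nonneg u_nonneg by (simp add: sum.distrib)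
    also have "\<dots> \<le> s + s * (\<Sum>n\<le>N. u n)"
      by (intro add_mono mult_right_mono partial sum_nonneg u_nonneg)
    finally show ?thesis using s1 by (simp add: S_def field_simps)
  qed
  define q' where "q' = (1 / 4 :: real) powr (- 3 / 2)"
  have q'0: "0 \<le> q'" by (simp add: q'_def)
  \<comment> \<open>\<open>K\<close> is the fixed point of the estimate at the end of the induction
    step. The denominator is positive by the assumption on \<open>s\<close>.\<close>
  define K where "K = (C + q' * C * S) / (1 - q * s)"
  have K: "C + q * s * K + q' * C * S = K" "0 \<le> K"
    using s C0 S0 q'0 by (auto simp: K_def q_def field_simps)
  have "u n \<le> K * decay n" for n
  proof (induction n rule: less_induct)
    case (less n)
    have summand: "a i * u (n - i) \<le> a i * (K * (q * decay n)) + q' * C * decay n * u (n - i)"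
      if i: "i \<le> n" for i
    \<comment> \<open>The term with \<open>u n\<close> itself, outside the induction hypothesis, is
      removed by \<open>a 0 = 0\<close>.\<close>
    proof (cases "i = 0")
      case True
      then show ?thesis using a0 q'0 C0 decay_pos[of n] u_nonneg by (simp add: less_imp_le)
    next
      case False
      show ?thesis
      proof (cases "4 * i \<le> n")
        case True
        have "u (n - i) \<le> K * decay (n - i)" using less.IH[of "n - i"] False i by simp
        also have "decay (n - i) \<le> q * decay n"
          unfolding q_def using True i by (intro decay_scale) (auto simp: of_nat_diff)
        finally have "u (n - i) \<le> K * (q * decay n)" using K(2) by (simp add: mult_left_mono)
        then have "a i * u (n - i) \<le> a i * (K * (q * decay n))"
          by (rule mult_left_mono[OF _ a_nonneg])
        also have "\<dots> \<le> a i * (K * (q * decay n)) + q' * C * decay n * u (n - i)"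
          using q'0 C0 decay_pos[of n] u_nonneg by (simp add: less_imp_le)
        finally show ?thesis .
      next
        case large: False
        have "decay i \<le> q' * decay n"
          unfolding q'_def using large i by (intro decay_scale) auto
        then have "C * decay i \<le> q' * C * decay n"
          using mult_left_mono[OF _ C0] by (simp only: mult.assoc mult.left_commute[of q'])
        then have "a i \<le> q' * C * decay n" using a_decay[of i] by linarith
        then have "a i * u (n - i) \<le> q' * C * decay n * u (n - i)"
          by (rule mult_right_mono[OF _ u_nonneg])
        also have "\<dots> \<le> a i * (K * (q * decay n)) + q' * C * decay n * u (n - i)"
          using a_nonneg K(2) q1 decay_pos[of n] by (simp add: less_imp_le)
        finally show ?thesis .
      qed
    qed
    have rev: "(\<Sum>i\<le>n. u (n - i)) = (\<Sum>i\<le>n. u i)"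
      by (rule sum.reindex_bij_witness[of _ "\<lambda>i. n - i" "\<lambda>i. n - i"]) auto
    have "u n \<le> a n + (\<Sum>i\<le>n. a i * u (n - i))" by (rule u)
    also have "\<dots> \<le> C * decay n + (\<Sum>i\<le>n. a i * (K * (q * decay n)) + q' * C * decay n * u (n - i))"
      by (intro add_mono a_decay sum_mono summand) auto
    also have "\<dots> = C * decay n + ((\<Sum>i\<le>n. a i) * (K * (q * decay n)) + q' * C * decay n * (\<Sum>i\<le>n. u i))"
      unfolding sum.distrib sum_distrib_left[symmetric] sum_distrib_right[symmetric] rev ..
    also have "\<dots> \<le> C * decay n + (s * (K * (q * decay n)) + q' * C * decay n * S)"
      using K(2) q1 q'0 C0 decay_pos[of n]
      by (intro add_mono order_refl mult_right_mono mult_left_mono partial U) (auto simp: less_imp_le)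
    also have "\<dots> = (C + q * s * K + q' * C * S) * decay n" by (simp add: algebra_simps)
    finally show ?case unfolding K(1) .
  qed
  then show ?thesis by (rule that)
qed

section \<open>Convolution with the coefficients of \<open>1 + x T'\<close>\<close>

lemma self_power_ratio_shift: "(\<lambda>n. self_power (n - k) / self_power n) \<longlonglongrightarrow> 1"
proof -
  have lim: "(\<lambda>n. self_power n / self_power (n + k)) \<longlonglongrightarrow> 1"
  proof (induction k)
    case 0
    have "self_power n / self_power n = 1" for n using self_power_pos[of n] by simp
    then show ?case by simp
  next
    case (Suc k)
    have "(\<lambda>n. self_power (Suc (n + k)) / self_power (n + k)) \<longlonglongrightarrow> 1"
      using LIMSEQ_ignore_initial_segment[OF self_power_ratio, of k] by simp
    then have "(\<lambda>n. self_power n / self_power (n + k) / (self_power (Suc (n + k)) / self_power (n + k)))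
        \<longlonglongrightarrow> 1 / 1"
      by (intro tendsto_divide Suc) auto
    moreover have "self_power n / self_power (n + k) / (self_power (Suc (n + k)) / self_power (n + k))
        = self_power n / self_power (n + Suc k)" for n
      using self_power_pos[of "n + k"] by (simp add: less_imp_neq[symmetric])
    ultimately show ?case by (simp only: div_by_1)
  qed
  show ?thesis by (rule LIMSEQ_offset[of _ k]) (use lim in simp)
qed

lemma sum_inverse_sqrt_le: "(\<Sum>j\<le>n. 1 / sqrt (real j + 1)) \<le> 2 * sqrt (real n + 1)"
proof (induction n)
  case (Suc n)
  define x y where "x = sqrt (real n + 1)" and "y = sqrt (real n + 2)"
  have xy: "0 < x" "x \<le> y" "y * y = x * x + 1" by (simp_all add: x_def y_def)
  have "2 * x * y \<le> x * x + y * y" using sum_squares_bound[of x y] by (simp add: power2_eq_square)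
  then have "2 * x + 1 / y \<le> 2 * y" using xy by (simp add: field_simps)
  then show ?case using Suc by (simp add: x_def y_def add.commute)
qed simp

lemma self_power_quotient_le:
  "self_power m / self_power n \<le> exp 1 * sqrt (real n + 1) * (1 / sqrt (real m + 1))"
proof -
  have m: "self_power m \<le> 1 / sqrt (real m + 1)"
    using self_power_bounds(2)[of m] by (simp add: field_simps)
  have "1 / self_power n \<le> exp 1 * sqrt (real n + 1)"
    using self_power_bounds(1)[of n] self_power_pos[of n] by (simp add: exp_minus field_simps)
  then have "self_power m * (1 / self_power n) \<le> 1 / sqrt (real m + 1) * (exp 1 * sqrt (real n + 1))"
    using m self_power_pos by (intro mult_mono) (auto simp: less_imp_le)
  then show ?thesis by (simp add: mult_ac)
qed

text \<open>The sum is split at \<open>k = n / 2\<close>. Below, the quotients are bounded uniformly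
  and tend to 1, so Tannery's theorem applies. Above, \<open>h\<close> is of order
  \<open>n powr (- 3 / 2)\<close> while the quotients add up to at most order \<open>n\<close>, so
  that part vanishes.\<close>

lemma convolution_limit:
  fixes h :: "nat \<Rightarrow> real"
  assumes h: "\<And>k. \<bar>h k\<bar> \<le> K * decay k"
  shows "(\<lambda>n. (\<Sum>k\<le>n. h k * self_power (n - k)) / self_power n) \<longlonglongrightarrow> suminf h"
proof -
  define r where "r k n = self_power (n - k) / self_power n" for k n
  have r0: "0 \<le> r k n" for k n by (simp add: r_def self_power_pos less_imp_le)
  have K0: "0 \<le> K" using h[of 0] by (simp add: decay_def)
  define a where "a k n = (if 2 * k \<le> n then h k * r k n else 0)" for k n
  define b where "b k n = (if 2 * k \<le> n then 0 else h k * r k n)" for k n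
  have "(\<lambda>n. \<Sum>k. a k n) \<longlonglongrightarrow> suminf h"
  proof (rule tannerys_theorem[THEN conjunct2, THEN conjunct2])
    fix k
    have "(\<lambda>n. h k * r k n) \<longlonglongrightarrow> h k * 1"
      unfolding r_def by (intro tendsto_intros self_power_ratio_shift)
    moreover have "eventually (\<lambda>n. h k * r k n = a k n) sequentially"
      using eventually_ge_at_top[of "2 * k"] by eventually_elim (simp add: a_def)
    ultimately show "(\<lambda>n. a k n) \<longlonglongrightarrow> h k" by (simp add: Lim_transform_eventually)
  next
    have "norm (a k n) \<le> K * decay k * (exp 1 * 2)" for k n
    proof (cases "2 * k \<le> n")
      case True
      \<comment> \<open>For \<open>2 * k <= n\<close> the index \<open>n - k\<close> is at least
        \<open>n / 2\<close>; the constant 4 is generous and has a rational root.\<close>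
      have "sqrt (real n + 1) \<le> sqrt (4 * (real (n - k) + 1))"
        using True by (intro real_sqrt_le_mono) (simp add: of_nat_diff)
      also have "\<dots> = 2 * sqrt (real (n - k) + 1)"
        by (simp only: real_sqrt_mult real_sqrt_four)
      finally have "sqrt (real n + 1) * (1 / sqrt (real (n - k) + 1)) \<le> 2"
        by (simp add: field_simps)
      then have "exp 1 * (sqrt (real n + 1) * (1 / sqrt (real (n - k) + 1))) \<le> exp 1 * 2"
        by (intro mult_left_mono) auto
      then have "r k n \<le> exp 1 * 2"
        unfolding r_def using self_power_quotient_le[of "n - k" n] by (simp only: mult.assoc)
      then show ?thesis
        using True h[of k] r0[of k n] K0 decay_pos[of k]
        by (simp add: a_def abs_mult) (intro mult_mono; simp add: less_imp_le)
    next
      case False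
      then show ?thesis using K0 decay_pos[of k] by (simp add: a_def less_imp_le)
    qed
    then show "eventually (\<lambda>(k, n). norm (a k n) \<le> K * decay k * (exp 1 * 2)) (at_top \<times>\<^sub>F sequentially)"
      by (intro always_eventually) auto
    show "summable (\<lambda>k. K * decay k * (exp 1 * 2))"
      by (intro summable_mult2 summable_mult summable_decay)
  qed simp
  moreover have "(\<Sum>k. a k n) = (\<Sum>k\<le>n. a k n)" for n
    by (rule suminf_finite) (auto simp: a_def)
  ultimately have A: "(\<lambda>n. \<Sum>k\<le>n. a k n) \<longlonglongrightarrow> suminf h" by simp
  define c where "c = K * (1 / 2) powr (- 3 / 2) * exp 1 * 2"
  have B: "(\<lambda>n. \<Sum>k\<le>n. b k n) \<longlonglongrightarrow> 0"
  proof (rule Lim_null_comparison)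
    have "norm (\<Sum>k\<le>n. b k n) \<le> c * (1 / sqrt (real n + 1))" for n
    proof -
      define d where "d = K * ((1 / 2) powr (- 3 / 2) * decay n) * (exp 1 * sqrt (real n + 1))"
      have "norm (b k n) \<le> d * (1 / sqrt (real (n - k) + 1))" if "k \<le> n" for k
      proof (cases "2 * k \<le> n")
        case True
        then show ?thesis using K0 decay_pos[of n] by (simp add: b_def d_def less_imp_le)
      next
        case False
        have "decay k \<le> (1 / 2) powr (- 3 / 2) * decay n"
          using False by (intro decay_scale) auto
        then have "\<bar>h k\<bar> \<le> K * ((1 / 2) powr (- 3 / 2) * decay n)"
          using h[of k] K0 by (meson mult_left_mono order_trans)
        then have "\<bar>h k\<bar> * r k n \<le> K * ((1 / 2) powr (- 3 / 2) * decay n)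
            * (exp 1 * sqrt (real n + 1) * (1 / sqrt (real (n - k) + 1)))"
          unfolding r_def using K0 decay_pos[of n] self_power_pos
          by (intro mult_mono self_power_quotient_le) (auto simp: less_imp_le)
        then show ?thesis using False r0[of k n] by (simp add: b_def d_def abs_mult mult_ac)
      qed
      then have "norm (\<Sum>k\<le>n. b k n) \<le> (\<Sum>k\<le>n. d * (1 / sqrt (real (n - k) + 1)))"
        by (intro sum_norm_le) auto
      also have "\<dots> = d * (\<Sum>k\<le>n. 1 / sqrt (real (n - k) + 1))"
        by (simp add: sum_distrib_left)
      also have "(\<Sum>k\<le>n. 1 / sqrt (real (n - k) + 1)) = (\<Sum>j\<le>n. 1 / sqrt (real j + 1))"
        by (rule sum.reindex_bij_witness[of _ "\<lambda>i. n - i" "\<lambda>i. n - i"]) auto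
      also have "d * \<dots> \<le> d * (2 * sqrt (real n + 1))"
        using K0 decay_pos[of n]
        by (intro mult_left_mono sum_inverse_sqrt_le) (simp add: d_def less_imp_le)
      also have "\<dots> = c * (1 / sqrt (real n + 1))"
      proof -
        have "decay n * sqrt (real n + 1) * sqrt (real n + 1) = 1 / sqrt (real n + 1)"
        proof -
          have aux: "1 / (y * t) * t * t = 1 / t" if "t * t = y" "0 < t" for t y :: real
            using that by auto
          show ?thesis unfolding decay_eq by (rule aux) auto
        qed
        moreover have "d * (2 * sqrt (real n + 1)) = c * (decay n * sqrt (real n + 1) * sqrt (real n + 1))"
          unfolding d_def c_def by (simp only: mult_ac)
        ultimately show ?thesis by simp
      qed
      finally show ?thesis .
    qed
    then show "eventually (\<lambda>n. norm (\<Sum>k\<le>n. b k n) \<le> c * (1 / sqrt (real n + 1))) sequentially"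
      by simp
    have "(\<lambda>n. 1 / sqrt (real n + 1)) \<longlonglongrightarrow> 0"
      using tendsto_real_sqrt[OF LIMSEQ_inverse_real_of_nat]
      by (simp add: real_sqrt_divide inverse_eq_divide add.commute)
    then show "(\<lambda>n. c * (1 / sqrt (real n + 1))) \<longlonglongrightarrow> 0"
      by (rule tendsto_mult_right_zero)
  qed
  have "(\<Sum>k\<le>n. h k * self_power (n - k)) / self_power n = (\<Sum>k\<le>n. a k n) + (\<Sum>k\<le>n. b k n)" for n
    unfolding sum.distrib[symmetric] sum_divide_distrib
    by (intro sum.cong refl) (simp add: a_def b_def r_def)
  then show ?thesis using tendsto_add[OF A B] by simp
qed

section \<open>Limits\<close>

lemma x_exp_x_less:
  fixes x y :: real
  assumes "x < y" "0 < y"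
  shows "x * exp x < y * exp y"
proof (cases "0 < x")
  case True
  then show ?thesis using assms by (intro mult_strict_mono) auto
next
  case False
  then have "x * exp x \<le> 0" by (simp add: mult_le_0_iff)
  also have "0 < y * exp y" using assms by simp
  finally show ?thesis .
qed

lemma x_exp_x_unique:
  fixes x y :: real
  assumes "x * exp x = 1" "y * exp y = 1"
  shows "x = y"
proof -
  have "0 < x" "0 < y" using assms by (smt (verit) exp_gt_zero mult_nonpos_nonneg)+
  then show ?thesis using x_exp_x_less[of x y] x_exp_x_less[of y x] assms by linarith
qed

text \<open>The number of terms is even, so the Lagrange remainder is nonnegative for either sign of
  \<open>x\<close>. Both signs occur below.\<close>

lemma exp_ge_taylor_12: "(\<Sum>m<12. x ^ m / fact m) \<le> exp x" for x :: real
proof -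
  obtain t where "exp x = (\<Sum>m<12. x ^ m / fact m) + exp t / fact 12 * x ^ 12"
    using Maclaurin_exp_le[of x 12] by blast
  moreover have "0 \<le> exp t / fact 12 * x ^ 12" by simp
  ultimately show ?thesis by linarith
qed

lemma x_exp_x_bounds:
  fixes w :: real
  assumes "w * exp w = 1"
  shows "0.5671432904 < w" "w < 0.5671432905"
proof -
  have w0: "0 < w" using assms by (smt (verit) exp_gt_zero mult_nonpos_nonneg)
  define l :: real where "l = 0.5671432904"
  have l0: "0 < l" by (simp add: l_def)
  define h :: real where "h = 0.5671432905"
  \<comment> \<open>Here \<open>l * exp l\<close> has to be bounded from above although only lower
    bounds for \<open>exp\<close> are at hand, so the polynomial is evaluated at
    \<open>- l\<close>.\<close>
  have "l < (\<Sum>m<12. (- l) ^ m / fact m)"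
    by (simp add: l_def lessThan_nat_numeral fact_numeral power_divide)
  then have "l < exp (- l)" using exp_ge_taylor_12[of "- l"] by linarith
  then have "l * exp l < exp (- l) * exp l" by (rule mult_strict_right_mono) simp
  then have "l * exp l < 1" by (simp add: exp_minus)
  moreover have "w * exp w \<le> l * exp l" if "w \<le> l"
    using that x_exp_x_less[of w l] l0 by (cases "w = l") auto
  ultimately show "0.5671432904 < w" using assms by (force simp: l_def)
  have "1 < h * (\<Sum>m<12. h ^ m / fact m)"
    by (simp add: h_def lessThan_nat_numeral fact_numeral power_divide)
  also have "\<dots> \<le> h * exp h" by (intro mult_left_mono exp_ge_taylor_12) (simp add: h_def)
  finally have "1 < h * exp h" .
  moreover have "h * exp h \<le> w * exp w" if "h \<le> w"
    using that x_exp_x_less[of h w] w0 by (cases "w = h") auto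
  ultimately show "w < 0.5671432905" using assms by (force simp: h_def)
qed

section \<open>The values of the two series at the singularity\<close>

lemma self_power_nth: "self_power n = scaled (1 + fps_X * fps_deriv T_fps) n"
proof (cases "n = 0")
  case False
  then have "real n ^ n = real n * real n ^ (n - 1)" by (cases n) simp_all
  then show ?thesis using False
    by (simp add: self_power_def scaled_def T_fps_def fps_X_deriv_nth del: fps_X_mult_nth)
qed (simp add: self_power_def scaled_def)

lemma scaled_T_fps: "n \<ge> 1 \<Longrightarrow> self_power n = real n * scaled T_fps n"
  unfolding self_power_nth
  by (simp add: scaled_def fps_X_deriv_nth del: fps_X_mult_nth)

lemma T_fps_nonneg: "0 \<le> T_fps $ n"
  by (simp add: T_fps_def)

lemma scaled_T_fps_decay: "scaled T_fps n \<le> 2 * decay n"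
proof (cases "n = 0")
  case False
  define x where "x = sqrt (real n + 1)"
  have x: "0 < x" by (simp add: x_def)
  have "real n * scaled T_fps n * x \<le> 1"
    using self_power_bounds(2)[of n] scaled_T_fps[of n] False by (simp add: x_def)
  moreover have "(real n + 1) * (scaled T_fps n * x) \<le> (2 * real n) * (scaled T_fps n * x)"
    using False x T_fps_nonneg[of n] by (intro mult_right_mono) (auto simp: scaled_def)
  ultimately have "(real n + 1) * x * scaled T_fps n \<le> 2" by (simp add: mult_ac)
  then show ?thesis
    unfolding decay_eq x_def[symmetric] using x by (simp add: pos_le_divide_eq mult.commute)
qed (simp add: scaled_def decay_def)

text \<open>The value \<open>t\<close> satisfies \<open>t = exp (t - 1)\<close>, that is
  \<open>ln t = t - 1\<close>, and the tangent meets the logarithm only at 1.\<close>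

lemma scaled_T_fps_sums: "scaled T_fps sums 1"
proof -
  have "summable (scaled T_fps)"
  proof (rule summable_comparison_test')
    show "summable (\<lambda>n. 2 * decay n)" by (intro summable_mult summable_decay)
    show "norm (scaled T_fps n) \<le> 2 * decay n" if "n \<ge> 0" for n
      using scaled_T_fps_decay[of n] T_fps_nonneg[of n] by (simp add: scaled_def)
  qed
  then obtain t where t: "scaled T_fps sums t" by (auto simp: summable_def)
  have "T_fps = fps_X * (fps_exp 1 oo T_fps)"
    by (rule fps_X_exp_unique[OF T_fps_ode T_fps_1 T_fps_0])
  from scaled_X_exp_value[OF this T_fps_0 T_fps_nonneg t t] have "t = exp (t - 1)" .
  then have "0 < t" "ln t = t - 1" by (metis exp_gt_zero, metis ln_exp)
  then show ?thesis using t ln_eq_minus_one by blast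
qed

text \<open>Convergence comes from domination by \<open>T_fps\<close>. Since \<open>T - L\<close>
  has the value \<open>1 - w\<close>, the functional equation becomes
  \<open>w = exp (- w)\<close>.\<close>

lemma scaled_light_sums:
  obtains w where "scaled (egf light_count) sums w" "w * exp w = 1"
proof -
  let ?L = "egf light_count"
  have L0: "?L $ 0 = 0" and L1: "?L $ 1 = 1"
    using count_1 by (simp_all add: egf_nth)
  have L: "0 \<le> ?L $ n" "0 \<le> (T_fps - ?L) $ n" for n
    unfolding egf_rooted_count[symmetric]
    by (simp_all add: egf_nth light_count_le divide_right_mono)
  have "summable (scaled ?L)"
  proof (rule summable_comparison_test')
    show "summable (scaled T_fps)" using scaled_T_fps_sums by (simp add: sums_iff)
    show "norm (scaled ?L n) \<le> scaled T_fps n" if "n \<ge> 0" for n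
      using L[of n] by (simp add: scaled_def divide_right_mono)
  qed
  then obtain w where w: "scaled ?L sums w" by (auto simp: summable_def)
  have "scaled (T_fps - ?L) = (\<lambda>n. scaled T_fps n - scaled ?L n)"
    by (simp add: fun_eq_iff scaled_diff)
  then have D: "scaled (T_fps - ?L) sums (1 - w)"
    using sums_diff[OF scaled_T_fps_sums w] by simp
  have "?L = fps_X * (fps_exp 1 oo (T_fps - ?L))"
    by (rule fps_X_exp_unique[OF egf_light_count_ode L1]) (simp add: L0)
  from scaled_X_exp_value[OF this _ L(2) w D] have "w = exp (- w)" by (simp add: L0)
  then have "w * exp w = exp (- w) * exp w" by simp
  then show ?thesis using w that by (simp add: exp_minus)
qed

text \<open>Existence is a by-product of counting: the value of the light series is a
  solution.\<close>

lemma x_exp_x_ex1: "\<exists>!w :: real. w * exp w = 1"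
  using scaled_light_sums x_exp_x_unique by metis

lemma Omega: "Omega * exp Omega = 1"
  unfolding Omega_def by (rule theI'[OF x_exp_x_ex1])

lemma Omega_bounds: "0.5671432904 < Omega" "Omega < 0.5671432905"
  using x_exp_x_bounds[OF Omega] by blast+

lemma scaled_light_sums_Omega: "scaled (egf light_count) sums Omega"
  using scaled_light_sums x_exp_x_unique[OF Omega] by metis

section \<open>The kernel \<open>L / (1 + L)\<close> and its decay\<close>

definition light_kernel :: "real fps" where
  "light_kernel = egf light_count * inverse (1 + egf light_count)"

lemma light_kernel_mult: "light_kernel * (1 + egf light_count) = egf light_count"
proof -
  have "inverse (1 + egf light_count) * (1 + egf light_count) = 1"
    by (rule inverse_mult_eq_1) (simp add: egf_nth)
  then show ?thesis by (simp add: light_kernel_def mult.assoc)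
qed

lemma light_kernel_ode:
  "fps_X * fps_deriv (egf light_count) = light_kernel * (1 + fps_X * fps_deriv T_fps)"
proof -
  let ?L = "egf light_count"
  have nz: "1 + ?L \<noteq> 0"
  proof
    assume "1 + ?L = 0"
    then have "(1 + ?L) $ 0 = 0" by simp
    then show False by (simp add: egf_nth)
  qed
  have "fps_X * fps_deriv ?L * (1 + ?L) = ?L * (1 + fps_X * fps_deriv T_fps)"
    using egf_light_count_ode by (simp add: algebra_simps)
  also have "\<dots> = light_kernel * (1 + fps_X * fps_deriv T_fps) * (1 + ?L)"
    by (subst (1) light_kernel_mult[symmetric]) (simp only: mult_ac)
  finally show ?thesis using nz by (simp only: mult_cancel_right) simp
qed

lemma scaled_light_decay: "\<bar>scaled (egf light_count) n\<bar> \<le> 2 * decay n"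
proof -
  have "\<bar>scaled (egf light_count) n\<bar> \<le> scaled T_fps n"
    unfolding egf_rooted_count[symmetric]
    by (simp add: scaled_def egf_nth light_count_le divide_right_mono)
  then show ?thesis using scaled_T_fps_decay[of n] by linarith
qed

text \<open>The identity \<open>H = L - L H\<close> is a renewal equation, so decay passes from
  \<open>L\<close> to \<open>H\<close> without complex analysis.\<close>

lemma light_kernel_rec:
  "scaled light_kernel n = scaled (egf light_count) n
     - (\<Sum>i\<le>n. scaled (egf light_count) i * scaled light_kernel (n - i))"
proof -
  have "light_kernel = egf light_count - egf light_count * light_kernel"
    using light_kernel_mult by (simp add: algebra_simps)
  then have "scaled light_kernel n = scaled (egf light_count - egf light_count * light_kernel) n"
    by simp
  then show ?thesis by (simp only: scaled_diff scaled_mult)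
qed

text \<open>\<open>renewal_decay\<close> is applied to absolute values with mass
  \<open>Omega\<close>. It works since \<open>(3 / 4) powr (- 3 / 2)\<close> is at most 5/3 and
  \<open>Omega\<close> is below 3/5; a split at \<open>n / 2\<close> would produce the factor
  \<open>2 powr (3 / 2)\<close>, which exceeds \<open>1 / Omega\<close>.\<close>

lemma light_kernel_decay: "\<exists>K. \<forall>n. \<bar>scaled light_kernel n\<bar> \<le> K * decay n"
proof (rule renewal_decay)
  let ?a = "scaled (egf light_count)"
  show "?a 0 = 0" by (simp add: scaled_def egf_nth)
  show nn: "0 \<le> ?a n" for n by (simp add: scaled_def egf_nth)
  show "?a n \<le> 2 * decay n" for n using scaled_light_decay[of n] by linarith
  show "?a sums Omega" by (rule scaled_light_sums_Omega)
  show "\<bar>scaled light_kernel n\<bar> \<le> ?a n + (\<Sum>i\<le>n. ?a i * \<bar>scaled light_kernel (n - i)\<bar>)" for n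
  proof -
    have "\<bar>\<Sum>i\<le>n. ?a i * scaled light_kernel (n - i)\<bar> \<le> (\<Sum>i\<le>n. \<bar>?a i * scaled light_kernel (n - i)\<bar>)"
      by (rule sum_abs)
    also have "\<dots> = (\<Sum>i\<le>n. ?a i * \<bar>scaled light_kernel (n - i)\<bar>)"
      using nn by (simp add: abs_mult)
    finally show ?thesis using light_kernel_rec[of n] nn[of n] by linarith
  qed
  have "(3 / 4 :: real) powr (- 3 / 2) = 1 / ((3 / 4) * sqrt (3 / 4))"
  proof -
    have "(3 / 4 :: real) powr (- 3 / 2) = (3 / 4) powr (- (1 + 1 / 2))" by simp
    also have "\<dots> = 1 / ((3 / 4) * sqrt (3 / 4))"
      by (subst powr_minus_divide, subst powr_add) (simp add: powr_half_sqrt)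
    finally show ?thesis .
  qed
  moreover have "4 / 5 \<le> sqrt (3 / 4 :: real)" by (rule real_le_rsqrt) (simp add: power2_eq_square)
  then have "1 / ((3 / 4) * sqrt (3 / 4)) \<le> 1 / ((3 / 4) * (4 / 5 :: real))"
    by (intro divide_left_mono mult_left_mono) auto
  ultimately have "(3 / 4 :: real) powr (- 3 / 2) \<le> 5 / 3" by simp
  then have "(3 / 4) powr (- 3 / 2) * Omega \<le> 5 / 3 * Omega"
    using Omega_bounds by (intro mult_right_mono) auto
  also have "5 / 3 * Omega < 1" using Omega_bounds by simp
  finally show "(3 / 4) powr (- 3 / 2) * Omega < 1" .
qed auto

text \<open>Summing the renewal equation by a Cauchy product gives
  \<open>h = Omega - Omega * h\<close> for the total \<open>h\<close>.\<close>

lemma light_kernel_suminf: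
  "summable (\<lambda>n. \<bar>scaled light_kernel n\<bar>)" "suminf (scaled light_kernel) = Omega / (1 + Omega)"
proof -
  obtain K where K: "\<And>n. \<bar>scaled light_kernel n\<bar> \<le> K * decay n" using light_kernel_decay by blast
  show H: "summable (\<lambda>n. \<bar>scaled light_kernel n\<bar>)"
    by (rule summable_comparison_test'[OF summable_mult[OF summable_decay, of K]]) (use K in auto)
  have L: "summable (\<lambda>n. norm (scaled (egf light_count) n))"
    by (rule summable_comparison_test'[OF summable_mult[OF summable_decay, of 2]])
      (use scaled_light_decay in auto)
  have "(\<lambda>n. \<Sum>i\<le>n. scaled (egf light_count) i * scaled light_kernel (n - i))
      sums (Omega * suminf (scaled light_kernel))"
    using Cauchy_product_sums[OF L, of "scaled light_kernel"] H scaled_light_sums_Omega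
    by (simp add: sums_iff)
  from sums_diff[OF scaled_light_sums_Omega this]
  have "scaled light_kernel sums (Omega - Omega * suminf (scaled light_kernel))"
    by (simp add: light_kernel_rec[symmetric])
  then have "suminf (scaled light_kernel) = Omega - Omega * suminf (scaled light_kernel)"
    by (simp add: sums_iff)
  then show "suminf (scaled light_kernel) = Omega / (1 + Omega)"
    using Omega_bounds by (simp add: field_simps)
qed

text \<open>Coefficient \<open>n\<close> of \<open>x F'\<close>, divided by that of
  \<open>1 + x T'\<close>, is precisely \<open>N n / n ^ (n - 1)\<close>, so
  \<open>convolution_limit\<close> yields the limit as the value of the kernel \<open>f\<close> at
  \<open>exp (- 1)\<close>.\<close>

lemma ratio_limit:
  assumes ode: "fps_X * fps_deriv (egf N) = f * (1 + fps_X * fps_deriv T_fps)"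
    and decay: "\<And>n. \<bar>scaled f n\<bar> \<le> K * decay n"
  shows "(\<lambda>n. real (N n) / real n ^ (n - 1)) \<longlonglongrightarrow> suminf (scaled f)"
proof -
  have "(\<Sum>k\<le>n. scaled f k * self_power (n - k)) / self_power n = real (N n) / real n ^ (n - 1)"
    if n: "n \<ge> 1" for n
  proof -
    have "(\<Sum>k\<le>n. scaled f k * self_power (n - k)) = scaled (fps_X * fps_deriv (egf N)) n"
      unfolding ode scaled_mult self_power_nth ..
    also have "\<dots> = real n * real (N n) / fact n / exp (real n)"
      using n by (simp add: scaled_def fps_X_deriv_nth egf_def del: fps_X_mult_nth)
    finally have "(\<Sum>k\<le>n. scaled f k * self_power (n - k)) / self_power n
        = real n * real (N n) / fact n / exp (real n) / self_power n" by simp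
    moreover have "real n ^ n = real n * real n ^ (n - 1)" using n by (cases n) simp_all
    ultimately show ?thesis using n by (simp add: self_power_def)
  qed
  then have "eventually (\<lambda>n. (\<Sum>k\<le>n. scaled f k * self_power (n - k)) / self_power n
      = real (N n) / real n ^ (n - 1)) sequentially"
    unfolding eventually_sequentially by blast
  with convolution_limit[OF decay] show ?thesis by (rule Lim_transform_eventually)
qed

lemma N_G_limit: "(\<lambda>n. real (N_G n) / real n ^ (n - 1)) \<longlonglongrightarrow> Omega / (1 + Omega)"
proof -
  obtain K where "\<And>n. \<bar>scaled light_kernel n\<bar> \<le> K * decay n" using light_kernel_decay by blast
  from ratio_limit[OF light_kernel_ode this] show ?thesis
    by (simp add: N_G_eq light_kernel_suminf)
qed

lemma Omega_red_eq: "2 * Omega\<^sup>2 / (1 + Omega) = 2 * Omega - 2 * (Omega / (1 + Omega))"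
  using Omega_bounds by (simp add: field_simps power2_eq_square)

text \<open>From \<open>x (L^2)' = 2 L H (1 + x T')\<close> and \<open>L H = L - H\<close> the
  kernel for red vertices is \<open>2 (L - H)\<close>; it inherits decay and value from
  \<open>L\<close> and \<open>H\<close>.\<close>

lemma N_R_limit: "(\<lambda>n. real (N_R n) / real n ^ (n - 1)) \<longlonglongrightarrow> 2 * Omega\<^sup>2 / (1 + Omega)"
proof -
  let ?L = "egf light_count"
  define f where "f = fps_const 2 * (?L - light_kernel)"
  obtain K where K: "\<And>n. \<bar>scaled light_kernel n\<bar> \<le> K * decay n" using light_kernel_decay by blast
  have f: "scaled f n = 2 * (scaled ?L n - scaled light_kernel n)" for n
    by (simp add: f_def scaled_def diff_divide_distrib)
  have LH: "?L * light_kernel = ?L - light_kernel"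
    using light_kernel_mult by (simp add: algebra_simps)
  have "egf N_R = ?L\<^sup>2" unfolding N_R_egf egf_light_count by simp
  then have "fps_X * fps_deriv (egf N_R) = fps_const 2 * (?L * (fps_X * fps_deriv ?L))"
    by (simp add: power2_eq_square mult_ac fps_numeral_fps_const[symmetric] del: fps_numeral_fps_const)
  also have "\<dots> = f * (1 + fps_X * fps_deriv T_fps)"
    unfolding light_kernel_ode f_def LH[symmetric] by (simp only: mult_ac)
  finally have ode: "fps_X * fps_deriv (egf N_R) = f * (1 + fps_X * fps_deriv T_fps)" .
  have "\<bar>scaled f n\<bar> \<le> (2 * (2 + K)) * decay n" for n
    using K[of n] scaled_light_decay[of n] unfolding f ring_distribs abs_le_iff by linarith
  from ratio_limit[OF ode this]
  have "(\<lambda>n. real (N_R n) / real n ^ (n - 1)) \<longlonglongrightarrow> suminf (scaled f)" .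
  moreover have "scaled f sums (2 * (Omega - Omega / (1 + Omega)))"
  proof -
    have "scaled light_kernel sums (Omega / (1 + Omega))"
      using light_kernel_suminf summable_rabs_cancel by (metis summable_sums)
    from sums_mult[OF sums_diff[OF scaled_light_sums_Omega this], of 2]
    show ?thesis by (simp add: f[abs_def])
  qed
  ultimately show ?thesis unfolding Omega_red_eq by (simp add: sums_iff)
qed

lemma N_B_limit:
  "(\<lambda>n. real (N_B n) / real n ^ (n - 1)) \<longlonglongrightarrow> 1 + Omega / (1 + Omega) - 2 * Omega"
proof -
  have "(\<lambda>n. 1 - real (N_R n) / real n ^ (n - 1) - real (N_G n) / real n ^ (n - 1))
      \<longlonglongrightarrow> 1 - 2 * Omega\<^sup>2 / (1 + Omega) - Omega / (1 + Omega)"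
    by (intro tendsto_diff tendsto_const N_R_limit N_G_limit)
  moreover have "1 - 2 * Omega\<^sup>2 / (1 + Omega) - Omega / (1 + Omega) = 1 + Omega / (1 + Omega) - 2 * Omega"
    unfolding Omega_red_eq by simp
  moreover have "eventually (\<lambda>n. 1 - real (N_R n) / real n ^ (n - 1) - real (N_G n) / real n ^ (n - 1)
      = real (N_B n) / real n ^ (n - 1)) sequentially"
    using eventually_ge_at_top[of 1] by eventually_elim (rule N_B_ratio[symmetric])
  ultimately show ?thesis by (simp add: Lim_transform_eventually)
qed

lemma Omega_ratio_bounds:
  "0.36189625663 < Omega / (1 + Omega)" "Omega / (1 + Omega) < 0.36189625671"
  using Omega_bounds by (simp_all add: field_simps)

theorem theorem2:
  shows "egf N_B = T_fps + fps_compose T_fps (- T_fps) - (fps_compose T_fps (- T_fps))\<^sup>2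
   \<and> egf N_R = (fps_compose T_fps (- T_fps))\<^sup>2
   \<and> egf N_G = - fps_compose T_fps (- T_fps)
   \<and> (\<forall>n\<ge>1. real (N_B n) / real n ^ (n - 1) =
          1 + (\<Sum>l=1..n. (- real l / real n) ^ l * (2 / real l - 1) * real (n choose l)))
   \<and> (\<forall>n\<ge>1. real (N_R n) / real n ^ (n - 1) =
          - 2 * (\<Sum>l=1..n. (- real l / real n) ^ l * (1 / real l - 1) * real (n choose l)))
   \<and> (\<forall>n\<ge>1. real (N_G n) / real n ^ (n - 1) =
          - (\<Sum>l=1..n. (- real l / real n) ^ l * real (n choose l)))
   \<and> map N_B [1..<11] = [0, 0, 3, 4, 185, 1026, 30457, 362664, 10245825, 195060070]
   \<and> map N_R [1..<11] = [0, 2, 0, 48, 120, 4560, 35700, 1048992, 15514128, 456726240]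
   \<and> map N_G [1..<11] = [1, 0, 6, 12, 320, 2190, 51492, 685496, 17286768, 348213690]
   \<and> (\<exists>!w::real. w * exp w = 1)
   \<and> \<bar>Omega - 0.567143\<bar> < 0.000001
   \<and> (\<lambda>n. real (N_B n) / real n ^ (n - 1)) \<longlonglongrightarrow> 1 + Omega / (1 + Omega) - 2 * Omega
   \<and> (\<lambda>n. real (N_R n) / real n ^ (n - 1)) \<longlonglongrightarrow> 2 * Omega\<^sup>2 / (1 + Omega)
   \<and> (\<lambda>n. real (N_G n) / real n ^ (n - 1)) \<longlonglongrightarrow> Omega / (1 + Omega)
   \<and> \<bar>(1 + Omega / (1 + Omega) - 2 * Omega) - 0.2276096757\<bar> < 0.000000001
   \<and> \<bar>2 * Omega\<^sup>2 / (1 + Omega) - 0.4104940676\<bar> < 0.000000001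
   \<and> \<bar>Omega / (1 + Omega) - 0.3618962567\<bar> < 0.000000001"
proof (intro conjI allI impI)
  \<comment> \<open>All three limits are linear in \<open>Omega\<close> and \<open>q\<close>, so
    enclosures of these two numbers settle every approximation by linear arithmetic.\<close>
  define q where "q = Omega / (1 + Omega)"
  note bounds = Omega_bounds Omega_ratio_bounds[folded q_def]
  show "\<bar>Omega - 0.567143\<bar> < 0.000001" using bounds by (simp add: abs_less_iff)
  show "\<bar>(1 + Omega / (1 + Omega) - 2 * Omega) - 0.2276096757\<bar> < 0.000000001"
    unfolding q_def[symmetric] abs_less_iff using bounds by simp
  show "\<bar>2 * Omega\<^sup>2 / (1 + Omega) - 0.4104940676\<bar> < 0.000000001"
    unfolding Omega_red_eq q_def[symmetric] abs_less_iff using bounds by simp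
  show "\<bar>Omega / (1 + Omega) - 0.3618962567\<bar> < 0.000000001"
    unfolding q_def[symmetric] abs_less_iff using bounds by simp
qed (use N_B_egf N_R_egf N_G_egf N_B_formula N_R_formula N_G_formula N_B_values N_R_values
  N_G_values x_exp_x_ex1 N_B_limit N_R_limit N_G_limit in blast)+

end
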